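(* Let $\mathcal{H}_1,\mathcal{H}_2$ be separable complex Hilbert spaces and $(X_1,\mu_1),(X_2,\mu_2)$ measure spaces with $\sigma$-finite positive measures. For $j=1,2$ let $m_j$ be a measurable function on $X_j$ and let $F_j,G_j$ be continuous Bessel mappings (frames) for $\mathcal{H}_j$ with respect to $(X_j,\mu_j)$. Let $m=m_1\otimes m_2$, $F=F_1\otimes F_2$ and $G=G_1\otimes G_2$. If $\mathbf{M}_{m,F,G}\in\mathcal{S}_1(\mathcal{H}_1\otimes\mathcal{H}_2)$, then its partial trace $T(\mathbf{M}_{m,F,G})$ with respect to $\mathcal{H}_1$ is a continuous Bessel (frame) multiplier given by $$T(\mathbf{M}_{m_1,F_1,G_1}\otimes\mathbf{M}_{m_2,F_2,G_2})=\mathbf{M}_{m_1,F_1,G_1}\,\mathrm{Tr}_{\mathcal{H}_2}(\mathbf{M}_{m_2,F_2,G_2}),$$ i.e. it is a trace class operator of "the same form" as $\mathbf{M}_{m,F,G}$. A similar statement holds for the partial trace of $\mathbf{M}_{m,F,G}$ with respect to $\mathcal{H}_2$.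
   Context: A weakly measurable mapping $F:X\to\mathcal{K}$ from a measure space $(X,\mu)$ into a separable Hilbert space $\mathcal{K}$ is a continuous frame for $\mathcal{K}$ with respect to $(X,\mu)$ if there are $A>0$, $B<\infty$ with $A\|f\|^2\le\int_X|\langle f,F(x)\rangle|^2\,d\mu(x)\le B\|f\|^2$ for all $f\in\mathcal{K}$; it is a (continuous) Bessel mapping if only the upper inequality is required. For Bessel mappings $F,G:X\to\mathcal{K}$ and measurable $m:X\to\mathbb{C}$ (the symbol), the continuous Bessel multiplier $\mathbf{M}_{m,F,G}:\mathcal{K}\to\mathcal{K}$ is weakly defined by $$\langle\mathbf{M}_{m,F,G}f,g\rangle=\int_X m(x)\langle f,F(x)\rangle\langle G(x),g\rangle\,d\mu(x),\qquad f,g\in\mathcal{K};$$ it is called a continuous frame multiplier if $F,G$ are continuous frames. For $\mathbf{M}_{m,F,G}$ with $m=m_1\otimes m_2$, $F=F_1\otimes F_2$, $G=G_1\otimes G_2$, the Hilbert space is $\mathcal{H}_1\otimes\mathcal{H}_2$ and the measure space is $(X_1\times X_2,\mu_1\otimes\mu_2)$. Notation: $(m_1\otimes m_2)(x_1,x_2)=m_1(x_1)m_2(x_2)$ and $(F_1\otimes F_2)(x_1,x_2)=F_1(x_1)\otimes F_2(x_2)$. $\mathcal{S}_1(\mathcal{K})$ denotes the trace class operators on $\mathcal{K}$ and $\mathrm{Tr}_{\mathcal{K}}$ the trace. The partial trace with respect to $\mathcal{H}_1$ is the continuous linear map $T:\mathcal{S}_1(\mathcal{H}_1\otimes\mathcal{H}_2)\to\mathcal{S}_1(\mathcal{H}_1)$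 with $T(A_1\otimes A_2)=A_1\,\mathrm{Tr}_{\mathcal{H}_2}(A_2)$ for all $A_j\in\mathcal{S}_1(\mathcal{H}_j)$, $j=1,2$, and $\mathrm{Tr}_{\mathcal{H}_1}(T(A))=\mathrm{Tr}_{\mathcal{H}_1\otimes\mathcal{H}_2}(A)$ for all $A\in\mathcal{S}_1(\mathcal{H}_1\otimes\mathcal{H}_2)$. The partial trace with respect to $\mathcal{H}_2$ is defined in a similar way. *)

theory Defs
  imports "HOL-Analysis.Analysis"
begin

text \<open>The inner product is linear in the first and conjugate linear in the second argument.\<close>

class complex_hilbert = banach +
  fixes scaleC :: "complex \<Rightarrow> 'a \<Rightarrow> 'a" (infixr "*\<^sub>C" 75)
    and cinner :: "'a \<Rightarrow> 'a \<Rightarrow> complex"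
  assumes scaleC_add_right: "a *\<^sub>C (x + y) = a *\<^sub>C x + a *\<^sub>C y"
    and scaleC_add_left: "(a + b) *\<^sub>C x = a *\<^sub>C x + b *\<^sub>C x"
    and scaleC_scaleC: "a *\<^sub>C b *\<^sub>C x = (a * b) *\<^sub>C x"
    and scaleR_scaleC: "r *\<^sub>R x = complex_of_real r *\<^sub>C x"
    and cinner_add_left: "cinner (x + y) z = cinner x z + cinner y z"
    and cinner_scaleC_left: "cinner (a *\<^sub>C x) y = a * cinner x y"
    and cinner_commute: "cinner x y = cnj (cinner y x)"
    and cinner_self: "cinner x x = complex_of_real ((norm x)\<^sup>2)"

lemma vector_space_scaleC: "vector_space (scaleC :: complex \<Rightarrow> 'a \<Rightarrow> 'a::complex_hilbert)"
proof
  show "1 *\<^sub>C x = x" for x :: 'a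
    using scaleR_scaleC[of 1 x] by simp
qed (rule scaleC_add_right scaleC_add_left scaleC_scaleC)+

instantiation complex :: complex_hilbert
begin

definition "scaleC_complex = ((*) :: complex \<Rightarrow> complex \<Rightarrow> complex)"
definition "cinner_complex = (\<lambda>x y :: complex. x * cnj y)"

instance
proof
  fix x y z a b :: complex and r :: real
  show "a *\<^sub>C (x + y) = a *\<^sub>C x + a *\<^sub>C y" "(a + b) *\<^sub>C x = a *\<^sub>C x + b *\<^sub>C x"
    "a *\<^sub>C b *\<^sub>C x = (a * b) *\<^sub>C x" "r *\<^sub>R x = complex_of_real r *\<^sub>C x"
    by (simp_all add: scaleC_complex_def distrib_left distrib_right scaleR_conv_of_real)
  show "cinner (x + y) z = cinner x z + cinner y z" "cinner (a *\<^sub>C x) y = a * cinner x y"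
    "cinner x y = cnj (cinner y x)"
    by (simp_all add: scaleC_complex_def cinner_complex_def distrib_right)
  show "cinner x x = complex_of_real ((norm x)\<^sup>2)"
    unfolding cinner_complex_def by (rule complex_norm_square[symmetric])
qed

end

abbreviation cspan :: "'a::complex_hilbert set \<Rightarrow> 'a set" where
  "cspan \<equiv> module.span scaleC"

definition bounded_clinear :: "('a::complex_hilbert \<Rightarrow> 'b::complex_hilbert) \<Rightarrow> bool" where
  "bounded_clinear A \<longleftrightarrow> bounded_linear A \<and> (\<forall>c x. A (c *\<^sub>C x) = c *\<^sub>C A x)"

definition is_onb :: "'a::complex_hilbert set \<Rightarrow> bool" where
  "is_onb E \<longleftrightarrow> (\<forall>e\<in>E. norm e = 1) \<and> (\<forall>e\<in>E. \<forall>e'\<in>E. e \<noteq> e' \<longrightarrow> cinner e e' = 0)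
    \<and> closure (cspan E) = UNIV"

definition positive_op :: "('a::complex_hilbert \<Rightarrow> 'a) \<Rightarrow> bool" where
  "positive_op P \<longleftrightarrow> bounded_clinear P \<and> (\<forall>x. cinner (P x) x \<in> \<real>\<^sub>\<ge>\<^sub>0)"

text \<open>The modulus \<open>|A|\<close>, i.e. the unique positive square root of \<open>A\<^sup>* A\<close>; the equation
  \<open>P P = A\<^sup>* A\<close> is written out weakly, without mentioning the adjoint.\<close>

definition abs_op :: "('a::complex_hilbert \<Rightarrow> 'a) \<Rightarrow> 'a \<Rightarrow> 'a" where
  "abs_op A = (THE P. positive_op P \<and> (\<forall>x y. cinner (P (P x)) y = cinner (A x) (A y)))"

definition trace_class :: "('a::complex_hilbert \<Rightarrow> 'a) \<Rightarrow> bool" where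
  "trace_class A \<longleftrightarrow> bounded_clinear A
    \<and> (\<exists>E. is_onb E \<and> (\<lambda>e. cinner (abs_op A e) e) summable_on E)"

text \<open>The trace and the trace norm do not depend on the orthonormal basis chosen here.\<close>

definition some_onb :: "'a::complex_hilbert set" where
  "some_onb = (SOME E. is_onb E)"

definition op_trace :: "('a::complex_hilbert \<Rightarrow> 'a) \<Rightarrow> complex" where
  "op_trace A = (if trace_class A then \<Sum>\<^sub>\<infinity>e\<in>some_onb. cinner (A e) e else 0)"

definition trace_norm :: "('a::complex_hilbert \<Rightarrow> 'a) \<Rightarrow> real" where
  "trace_norm A = (\<Sum>\<^sub>\<infinity>e\<in>some_onb. Re (cinner (abs_op A e) e))"

text \<open>\<open>hilbert_tensor t\<close> says that the type \<open>'k\<close>, with \<open>t x y\<close> as the simple tensor of \<open>x\<close> and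
  \<open>y\<close>, is the Hilbert space tensor product of \<open>'a\<close> and \<open>'b\<close>. This determines \<open>('k, t)\<close> up to a
  unique unitary isomorphism.\<close>

definition hilbert_tensor ::
    "('a::complex_hilbert \<Rightarrow> 'b::complex_hilbert \<Rightarrow> 'k::complex_hilbert) \<Rightarrow> bool" where
  "hilbert_tensor t \<longleftrightarrow>
     (\<forall>x x' y. t (x + x') y = t x y + t x' y) \<and>
     (\<forall>x y y'. t x (y + y') = t x y + t x y') \<and>
     (\<forall>c x y. t (c *\<^sub>C x) y = c *\<^sub>C t x y \<and> t x (c *\<^sub>C y) = c *\<^sub>C t x y) \<and>
     (\<forall>x x' y y'. cinner (t x y) (t x' y') = cinner x x' * cinner y y') \<and>
     closure (cspan {t x y |x y. True}) = UNIV"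

text \<open>The operator \<open>A \<otimes> B\<close>. It exists and is unique for bounded operators \<open>A\<close> and \<open>B\<close>.\<close>

definition op_tensor ::
    "('a::complex_hilbert \<Rightarrow> 'b::complex_hilbert \<Rightarrow> 'k::complex_hilbert)
      \<Rightarrow> ('a \<Rightarrow> 'a) \<Rightarrow> ('b \<Rightarrow> 'b) \<Rightarrow> 'k \<Rightarrow> 'k" where
  "op_tensor t A B = (THE C. bounded_clinear C \<and> (\<forall>x y. C (t x y) = t (A x) (B y)))"

text \<open>\<open>T\<close> is the partial trace with respect to the first factor. Only its values on trace class
  operators are constrained; continuity refers to the trace norms.\<close>

definition is_partial_trace_fst ::
    "('a::complex_hilbert \<Rightarrow> 'b::complex_hilbert \<Rightarrow> 'k::complex_hilbert)
      \<Rightarrow> (('k \<Rightarrow> 'k) \<Rightarrow> 'a \<Rightarrow> 'a) \<Rightarrow> bool" where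
  "is_partial_trace_fst t T \<longleftrightarrow>
     (\<forall>A. trace_class A \<longrightarrow> trace_class (T A)) \<and>
     (\<forall>A B. trace_class A \<longrightarrow> trace_class B \<longrightarrow> T (\<lambda>f. A f + B f) = (\<lambda>x. T A x + T B x)) \<and>
     (\<forall>c A. trace_class A \<longrightarrow> T (\<lambda>f. c *\<^sub>C A f) = (\<lambda>x. c *\<^sub>C T A x)) \<and>
     (\<forall>A. trace_class A \<longrightarrow> (\<forall>\<epsilon>>0. \<exists>\<delta>>0. \<forall>B. trace_class B \<longrightarrow>
        trace_norm (\<lambda>f. B f - A f) < \<delta> \<longrightarrow> trace_norm (\<lambda>x. T B x - T A x) < \<epsilon>)) \<and>
     (\<forall>A B. trace_class A \<longrightarrow> trace_class B \<longrightarrow>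
        T (op_tensor t A B) = (\<lambda>x. op_trace B *\<^sub>C A x)) \<and>
     (\<forall>A. trace_class A \<longrightarrow> op_trace (T A) = op_trace A)"

text \<open>For the second factor, exchange the roles of the two spaces: with \<open>t'\<close> the flipped tensor
  map, \<open>op_tensor t' B A\<close> is the operator \<open>A \<otimes> B\<close>, which is sent to the operator \<open>B\<close>
  multiplied by the trace of \<open>A\<close>.\<close>

definition is_partial_trace_snd ::
    "('a::complex_hilbert \<Rightarrow> 'b::complex_hilbert \<Rightarrow> 'k::complex_hilbert)
      \<Rightarrow> (('k \<Rightarrow> 'k) \<Rightarrow> 'b \<Rightarrow> 'b) \<Rightarrow> bool" where
  "is_partial_trace_snd t T \<longleftrightarrow> is_partial_trace_fst (\<lambda>y x. t x y) T"

definition weakly_measurable :: "'x measure \<Rightarrow> ('x \<Rightarrow> 'a::complex_hilbert) \<Rightarrow> bool" where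
  "weakly_measurable X F \<longleftrightarrow> (\<forall>f. (\<lambda>x. cinner f (F x)) \<in> borel_measurable X)"

definition bessel_mapping :: "'x measure \<Rightarrow> ('x \<Rightarrow> 'a::complex_hilbert) \<Rightarrow> bool" where
  "bessel_mapping X F \<longleftrightarrow> weakly_measurable X F \<and>
     (\<exists>B\<ge>0. \<forall>f. (\<integral>\<^sup>+x. ennreal ((cmod (cinner f (F x)))\<^sup>2) \<partial>X) \<le> ennreal (B * (norm f)\<^sup>2))"

definition continuous_frame :: "'x measure \<Rightarrow> ('x \<Rightarrow> 'a::complex_hilbert) \<Rightarrow> bool" where
  "continuous_frame X F \<longleftrightarrow> weakly_measurable X F \<and>
     (\<exists>A>0. \<exists>B\<ge>0. \<forall>f.
        ennreal (A * (norm f)\<^sup>2) \<le> (\<integral>\<^sup>+x. ennreal ((cmod (cinner f (F x)))\<^sup>2) \<partial>X) \<and>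
        (\<integral>\<^sup>+x. ennreal ((cmod (cinner f (F x)))\<^sup>2) \<partial>X) \<le> ennreal (B * (norm f)\<^sup>2))"

text \<open>For an unbounded symbol the defining integrals need not converge. \<open>has_multiplier X m F G A\<close>
  says that they all do and that they define the operator \<open>A\<close>, which is then unique;
  \<open>multiplier X m F G\<close> is this operator, and by convention the zero operator if there is none.\<close>

definition has_multiplier ::
    "'x measure \<Rightarrow> ('x \<Rightarrow> complex) \<Rightarrow> ('x \<Rightarrow> 'a::complex_hilbert) \<Rightarrow> ('x \<Rightarrow> 'a) \<Rightarrow> ('a \<Rightarrow> 'a) \<Rightarrow> bool"
  where
  "has_multiplier X m F G A \<longleftrightarrow> (\<forall>f g.
     integrable X (\<lambda>x. m x * cinner f (F x) * cinner (G x) g) \<and>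
     cinner (A f) g = (\<integral>x. m x * cinner f (F x) * cinner (G x) g \<partial>X))"

definition multiplier ::
    "'x measure \<Rightarrow> ('x \<Rightarrow> complex) \<Rightarrow> ('x \<Rightarrow> 'a::complex_hilbert) \<Rightarrow> ('x \<Rightarrow> 'a) \<Rightarrow> 'a \<Rightarrow> 'a" where
  "multiplier X m F G =
     (if \<exists>A. has_multiplier X m F G A then THE A. has_multiplier X m F G A else (\<lambda>_. 0))"

definition bessel_multiplier ::
    "'x measure \<Rightarrow> ('x \<Rightarrow> complex) \<Rightarrow> ('x \<Rightarrow> 'a::complex_hilbert) \<Rightarrow> ('x \<Rightarrow> 'a) \<Rightarrow> ('a \<Rightarrow> 'a) \<Rightarrow> bool"
  where
  "bessel_multiplier X m F G A \<longleftrightarrow> m \<in> borel_measurable X \<and>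
     bessel_mapping X F \<and> bessel_mapping X G \<and> has_multiplier X m F G A"

definition frame_multiplier ::
    "'x measure \<Rightarrow> ('x \<Rightarrow> complex) \<Rightarrow> ('x \<Rightarrow> 'a::complex_hilbert) \<Rightarrow> ('x \<Rightarrow> 'a) \<Rightarrow> ('a \<Rightarrow> 'a) \<Rightarrow> bool"
  where
  "frame_multiplier X m F G A \<longleftrightarrow> m \<in> borel_measurable X \<and>
     continuous_frame X F \<and> continuous_frame X G \<and> has_multiplier X m F G A"

end

theory Submission
  imports Defs
begin

text \<open>On simple tensors the matrix entries of \<open>M\<close> are integrals of product functions, so by Fubini
  \<open>\<langle>M (f \<otimes> f'), g \<otimes> g'\<rangle> = q1(f, g) q2(f', g')\<close>, where \<open>q1\<close> and \<open>q2\<close> are the sesquilinear forms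
  of the two factor multipliers (\<open>entry_product\<close>).

  If \<open>M \<noteq> 0\<close>, some entry is nonzero. Fixing \<open>f'\<close> and \<open>g'\<close> with \<open>q2(f', g') \<noteq> 0\<close> shows that \<open>q1\<close> is a
  convergent bounded form, hence by the Riesz representation theorem it belongs to a bounded
  operator, which is the multiplier \<open>M1\<close>; symmetrically for \<open>M2\<close>. So \<open>M = M1 \<otimes> M2\<close>. The factors are
  trace class because \<open>|M| = |M1| \<otimes> |M2|\<close> (\<open>abs_op_tensor\<close>): if \<open>y\<close> is a unit vector with
  \<open>\<langle>|M2| y, y\<rangle> > 0\<close>, then the vectors \<open>e \<otimes> y\<close>, with \<open>e\<close> in an orthonormal basis, form an orthonormal
  system on which the diagonal of \<open>|M|\<close> is a positive multiple of the diagonal of \<open>|M1|\<close>, and the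
  diagonal of a positive trace class operator is summable along any orthonormal system
  (\<open>trace_class_orthonormal_bound\<close>). The defining property of the partial trace on simple tensors
  then gives its value.

  If \<open>M = 0\<close>, one of the two factor multipliers exists and vanishes (\<open>zero_has_zero_factor\<close>), and all
  claims reduce to statements about zero operators, whatever the convergence of the other factor.

  The operator theory behind this rests on square roots of positive operators. The root of a
  positive contraction is the limit of polynomials in it, so it commutes with everything that
  commutes with the operator; this gives uniqueness, and hence a handle on the modulus. The root of
  \<open>1 - A\<^sup>* A\<close> also gives a direct bound for \<open>A \<otimes> 1\<close> (\<open>tensor_graph_isometry\<close>).\<close>

section \<open>Inner products and bounded operators\<close>

interpretation cvs: vector_space "scaleC :: complex \<Rightarrow> 'a \<Rightarrow> 'a::complex_hilbert"
  by (rule vector_space_scaleC)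

lemma cinner_add_right: "cinner x (y + z) = cinner x y + cinner x z"
  for x :: "'a::complex_hilbert"
  using cinner_commute[of x "y + z"] cinner_commute[of x y] cinner_commute[of x z]
  by (simp add: cinner_add_left)

lemma cinner_scaleC_right: "cinner x (a *\<^sub>C y) = cnj a * cinner x y"
  for x :: "'a::complex_hilbert"
  using cinner_commute[of x "a *\<^sub>C y"] cinner_commute[of x y]
  by (simp add: cinner_scaleC_left)

lemma cinner_scaleR_left: "cinner (r *\<^sub>R x) y = of_real r * cinner x y"
  for x :: "'a::complex_hilbert"
  by (simp add: scaleR_scaleC cinner_scaleC_left)

lemma cinner_scaleR_right: "cinner x (r *\<^sub>R y) = of_real r * cinner x y"
  for x :: "'a::complex_hilbert"
  by (simp add: scaleR_scaleC cinner_scaleC_right)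

lemma Re_cinner_self: "Re (cinner x x) = (norm x)\<^sup>2"
  for x :: "'a::complex_hilbert"
  by (simp add: cinner_self)

text \<open>Stated for arbitrary positive semidefinite hermitian forms, because it is applied both to the
  inner product and to the form \<open>\<langle>P x, y\<rangle>\<close> of a positive operator.\<close>

lemma form_Cauchy_Schwarz:
  fixes f :: "'a::complex_hilbert \<Rightarrow> 'a \<Rightarrow> complex"
  assumes add: "\<And>x y z. f (x + y) z = f x z + f y z"
    and scale: "\<And>c x y. f (c *\<^sub>C x) y = c * f x y"
    and herm: "\<And>x y. f x y = cnj (f y x)"
    and pos: "\<And>x. Re (f x x) \<ge> 0"
  shows "(cmod (f x y))\<^sup>2 \<le> Re (f x x) * Re (f y y)"
proof -
  define a b c where "a = Re (f x x)" and "b = Re (f y y)" and "c = f x y"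
  have add': "f x (y + z) = f x y + f x z" for x y z
    using herm[of x "y + z"] herm[of x y] herm[of x z] by (simp add: add)
  have scale': "f x (d *\<^sub>C y) = cnj d * f x y" for d x y
    using herm[of x "d *\<^sub>C y"] herm[of x y] by (simp add: scale)
  have fxx: "f x x = of_real a" and fyy: "f y y = of_real b"
    using herm[of x x] herm[of y y] by (auto simp: a_def b_def complex_eq_iff)
  have quad: "0 \<le> a - 2 * r * (cmod c)\<^sup>2 + r\<^sup>2 * (cmod c)\<^sup>2 * b" for r :: real
  proof -
    define s where "s = - (of_real r * c)"
    have "f (x + s *\<^sub>C y) (x + s *\<^sub>C y) = f x x + cnj s * f x y + s * f y x + s * cnj s * f y y"
      by (simp add: add add' scale scale' algebra_simps)
    also have "\<dots>
        = of_real a - of_real (2 * r) * (c * cnj c) + of_real (r\<^sup>2) * (c * cnj c) * of_real b"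
      using herm[of y x]
      by (simp add: s_def fxx fyy c_def[symmetric] algebra_simps power2_eq_square)
    also have "\<dots> = of_real (a - 2 * r * (cmod c)\<^sup>2 + r\<^sup>2 * (cmod c)\<^sup>2 * b)"
      by (simp add: complex_norm_square[symmetric])
    finally show ?thesis
      using pos[of "x + s *\<^sub>C y"] by simp
  qed
  have ab: "a \<ge> 0" "b \<ge> 0" using pos by (auto simp: a_def b_def)
  have "(cmod c)\<^sup>2 \<le> a * b"
  proof (cases "b = 0")
    case True
    \<comment> \<open>For \<open>b = 0\<close> the quadratic in \<open>r\<close> is affine with slope \<open>- 2 |c|\<^sup>2\<close>.\<close>
    have "c = 0"
    proof (rule ccontr)
      assume "c \<noteq> 0"
      then have c: "(cmod c)\<^sup>2 > 0" by simp
      show False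
        using quad[of "(a + 1) / (2 * (cmod c)\<^sup>2)"] c True by simp
    qed
    then show ?thesis using True by simp
  next
    case False
    then have "b > 0" using ab by simp
    \<comment> \<open>\<open>r = 1/b\<close> is the minimum of the quadratic.\<close>
    have "0 \<le> b * (a - 2 * (1/b) * (cmod c)\<^sup>2 + (1/b)\<^sup>2 * (cmod c)\<^sup>2 * b)"
      using quad[of "1/b"] ab by simp
    also have "\<dots> = a * b - (cmod c)\<^sup>2"
      using \<open>b > 0\<close> by (simp add: field_simps power2_eq_square)
    finally show ?thesis by simp
  qed
  then show ?thesis by (simp add: a_def b_def c_def)
qed

lemma Cauchy_Schwarz: "cmod (cinner x y) \<le> norm x * norm y"
  for x :: "'a::complex_hilbert"
proof -
  have "(cmod (cinner x y))\<^sup>2 \<le> (norm x * norm y)\<^sup>2"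
    unfolding power_mult_distrib Re_cinner_self[of x, symmetric] Re_cinner_self[of y, symmetric]
    by (rule form_Cauchy_Schwarz)
      (simp_all only: cinner_add_left cinner_scaleC_left cinner_commute[symmetric] Re_cinner_self
        zero_le_power2)
  then show ?thesis by (rule power2_le_imp_le) simp
qed

lemma bounded_bilinear_cinner:
  "bounded_bilinear (cinner :: 'a::complex_hilbert \<Rightarrow> 'a \<Rightarrow> complex)"
proof
  show "\<exists>K. \<forall>a b :: 'a. cmod (cinner a b) \<le> norm a * norm b * K"
    by (intro exI[of _ 1]) (simp add: Cauchy_Schwarz)
qed (simp_all add: cinner_add_left cinner_add_right cinner_scaleR_left cinner_scaleR_right
    scaleR_conv_of_real)

interpretation cinner: bounded_bilinear "cinner :: 'a::complex_hilbert \<Rightarrow> 'a \<Rightarrow> complex"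
  by (rule bounded_bilinear_cinner)

lemma cinner_eq_zero_iff [simp]: "cinner x x = 0 \<longleftrightarrow> x = 0"
  for x :: "'a::complex_hilbert"
  by (simp add: cinner_self)

lemma cinner_eqI:
  fixes x y :: "'a::complex_hilbert"
  assumes "\<And>z. cinner x z = cinner y z"
  shows "x = y"
proof -
  have "cinner (x - y) (x - y) = 0"
    using assms[of "x - y"] by (simp add: cinner.diff_left)
  then show ?thesis by simp
qed

lemma norm_scaleC: "norm (c *\<^sub>C x) = cmod c * norm x"
  for x :: "'a::complex_hilbert"
proof -
  have "complex_of_real ((norm (c *\<^sub>C x))\<^sup>2) = c * cnj c * of_real ((norm x)\<^sup>2)"
    unfolding cinner_self[symmetric] by (simp add: cinner_scaleC_left cinner_scaleC_right)
  also have "\<dots> = of_real ((cmod c * norm x)\<^sup>2)"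
    by (simp only: complex_norm_square[symmetric] of_real_mult power_mult_distrib)
  finally have "(norm (c *\<^sub>C x))\<^sup>2 = (cmod c * norm x)\<^sup>2"
    by (simp only: of_real_eq_iff)
  then show ?thesis by (simp add: power2_eq_iff_nonneg)
qed

lemma norm_add_sq: "(norm (x + y))\<^sup>2 = (norm x)\<^sup>2 + 2 * Re (cinner x y) + (norm y)\<^sup>2"
  for x :: "'a::complex_hilbert"
  using arg_cong[OF cinner_commute[of y x], of Re]
  by (simp add: Re_cinner_self[symmetric] cinner_add_left cinner_add_right)

lemma norm_diff_sq: "(norm (x - y))\<^sup>2 = (norm x)\<^sup>2 - 2 * Re (cinner x y) + (norm y)\<^sup>2"
  for x :: "'a::complex_hilbert"
  using norm_add_sq[of x "- y"] by (simp add: cinner.minus_right)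

lemma bounded_clinearI:
  fixes A :: "'a::complex_hilbert \<Rightarrow> 'b::complex_hilbert"
  assumes "\<And>x y. A (x + y) = A x + A y" "\<And>c x. A (c *\<^sub>C x) = c *\<^sub>C A x"
    "\<And>x. norm (A x) \<le> norm x * K"
  shows "bounded_clinear A"
  unfolding bounded_clinear_def using assms
  by (auto intro!: bounded_linear_intro[where K = K] simp: scaleR_scaleC)

lemma bounded_clinear_linear: "bounded_clinear A \<Longrightarrow> bounded_linear A"
  and bounded_clinear_scaleC: "bounded_clinear A \<Longrightarrow> A (c *\<^sub>C x) = c *\<^sub>C A x"
  by (simp_all add: bounded_clinear_def)

lemma bounded_clinear_add: "bounded_clinear A \<Longrightarrow> A (x + y) = A x + A y"
  by (simp add: bounded_clinear_def bounded_linear.axioms(1) linear_add bounded_linear.linear)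

lemma bounded_clinear_compose:
  "bounded_clinear A \<Longrightarrow> bounded_clinear B \<Longrightarrow> bounded_clinear (\<lambda>x. A (B x))"
  by (simp add: bounded_clinear_def bounded_linear_compose)

lemma bounded_linear_scaleC: "bounded_linear (scaleC c :: 'a \<Rightarrow> 'a::complex_hilbert)"
  by (rule bounded_linear_intro[where K = "cmod c"])
    (simp_all add: scaleC_add_right scaleR_scaleC scaleC_scaleC norm_scaleC mult.commute)

lemma bounded_clinear_scale: "bounded_clinear A \<Longrightarrow> bounded_clinear (\<lambda>x. c *\<^sub>C A x)"
  by (auto simp add: bounded_clinear_def scaleC_scaleC mult.commute
      intro: bounded_linear_compose[OF bounded_linear_scaleC])

lemma bounded_clinear_diff:
  "bounded_clinear A \<Longrightarrow> bounded_clinear B \<Longrightarrow> bounded_clinear (\<lambda>x. A x - B x)"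
  by (simp add: bounded_clinear_def bounded_linear_sub cvs.scale_right_diff_distrib)

lemma bounded_clinear_id: "bounded_clinear (\<lambda>x. x)"
  by (simp add: bounded_clinear_def)

lemma bounded_clinear_zero: "bounded_clinear (\<lambda>_. 0)"
  by (simp add: bounded_clinear_def)

lemma bounded_clinear_eq_on_dense:
  fixes A B :: "'a::complex_hilbert \<Rightarrow> 'b::complex_hilbert"
  assumes A: "bounded_clinear A" and B: "bounded_clinear B"
    and dense: "closure (cspan S) = UNIV" and eq: "\<And>s. s \<in> S \<Longrightarrow> A s = B s"
  shows "A = B"
proof
  fix x
  interpret A: bounded_linear A using A by (rule bounded_clinear_linear)
  interpret B: bounded_linear B using B by (rule bounded_clinear_linear)
  have span: "A x = B x" if "x \<in> cspan S" for x
    using that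
    by (induction rule: cvs.span_induct_alt)
      (simp_all add: A.zero B.zero A.add B.add bounded_clinear_scaleC A B eq)
  have "closed {x. A x = B x}"
    by (intro closed_Collect_eq linear_continuous_on A.bounded_linear B.bounded_linear)
  then have "closure (cspan S) \<subseteq> {x. A x = B x}"
    using span by (intro closure_minimal) auto
  then show "A x = B x" using dense by auto
qed

lemma cinner_eq_on_dense:
  fixes x y :: "'a::complex_hilbert"
  assumes dense: "closure (cspan S) = UNIV" and eq: "\<And>s. s \<in> S \<Longrightarrow> cinner x s = cinner y s"
  shows "x = y"
proof -
  have "bounded_clinear (\<lambda>z. cinner z w)" for w :: 'a
    unfolding bounded_clinear_def
    by (simp add: cinner.bounded_linear_left cinner_scaleC_left scaleC_complex_def)
  note bounded = this
  have "(\<lambda>z. cinner z x) = (\<lambda>z. cinner z y)"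
  proof (rule bounded_clinear_eq_on_dense[OF bounded bounded dense])
    show "cinner s x = cinner s y" if "s \<in> S" for s
      using eq[OF that] cinner_commute[of s x] cinner_commute[of s y] by simp
  qed
  then have *: "cinner z x = cinner z y" for z by (rule fun_cong)
  show ?thesis
    by (rule cinner_eqI) (simp add: cinner_commute[of x] cinner_commute[of y] *)
qed

section \<open>The Riesz representation theorem and adjoints\<close>

text \<open>The representing vector minimises \<open>J x = \<parallel>x\<parallel>\<^sup>2 - 2 Re (\<phi> x)\<close>: if \<open>\<phi> = \<langle>\<cdot>, v\<rangle>\<close>, then
  \<open>J x = \<parallel>x - v\<parallel>\<^sup>2 - \<parallel>v\<parallel>\<^sup>2\<close>. By the parallelogram law minimising sequences are Cauchy.\<close>

lemma Riesz_representation: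
  fixes \<phi> :: "'a::complex_hilbert \<Rightarrow> complex"
  assumes "bounded_clinear \<phi>"
  shows "\<exists>v. \<forall>x. \<phi> x = cinner x v"
proof -
  interpret \<phi>: bounded_linear \<phi> using assms by (rule bounded_clinear_linear)
  have \<phi>_scale: "\<phi> (c *\<^sub>C x) = c * \<phi> x" for c x
    using bounded_clinear_scaleC[OF assms, of c x] by (simp add: scaleC_complex_def)
  define J where "J x = (norm x)\<^sup>2 - 2 * Re (\<phi> x)" for x
  obtain K where K: "K > 0" "\<And>x. cmod (\<phi> x) \<le> norm x * K"
    using \<phi>.pos_bounded by blast
  have J_lower: "J x \<ge> - K\<^sup>2" for x
  proof -
    have "Re (\<phi> x) \<le> norm x * K"
      using K(2)[of x] complex_Re_le_cmod[of "\<phi> x"] by linarith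
    moreover have "0 \<le> (norm x - K)\<^sup>2" by simp
    ultimately show ?thesis
      by (simp add: J_def power2_diff)
  qed
  define d where "d = Inf (range J)"
  have bdd: "bdd_below (range J)" using J_lower by (auto intro!: bdd_belowI)
  have d_le: "d \<le> J x" for x
    unfolding d_def using bdd by (auto intro: cInf_lower)
  have "\<exists>x. J x < d + inverse (real (Suc n))" for n
    using cInf_lessD[of "range J" "d + inverse (real (Suc n))"] by (auto simp: d_def)
  then obtain u where u: "\<And>n. J (u n) < d + inverse (real (Suc n))" by metis
  have parallelogram: "(norm (x - y))\<^sup>2 \<le> 2 * (J x - d) + 2 * (J y - d)" for x y
  proof -
    have *: "(norm ((1/2) *\<^sub>R (x + y)))\<^sup>2 = (norm (x + y))\<^sup>2 / 4"
      by (simp add: power_divide)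
    have "4 * J ((1/2) *\<^sub>R (x + y)) = (norm (x + y))\<^sup>2 - 4 * Re (\<phi> x) - 4 * Re (\<phi> y)"
      unfolding J_def * by (simp add: \<phi>.scaleR \<phi>.add field_simps)
    moreover have "4 * d \<le> 4 * J ((1/2) *\<^sub>R (x + y))"
      using d_le by simp
    ultimately show ?thesis
      using norm_add_sq[of x y] norm_diff_sq[of x y] by (simp add: J_def)
  qed
  have "Cauchy u"
  proof (rule metric_CauchyI)
    fix e :: real assume e: "e > 0"
    obtain N where N: "inverse (real (Suc N)) < e\<^sup>2 / 4"
      using reals_Archimedean[of "e\<^sup>2 / 4"] e by auto
    have J_small: "J (u n) - d < e\<^sup>2 / 4" if "n \<ge> N" for n
    proof -
      have "inverse (real (Suc n)) \<le> inverse (real (Suc N))"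
        using that by (intro le_imp_inverse_le) auto
      then show ?thesis using u[of n] N by linarith
    qed
    have "dist (u m) (u n) < e" if "m \<ge> N" "n \<ge> N" for m n
    proof -
      have "(norm (u m - u n))\<^sup>2 \<le> 2 * (J (u m) - d) + 2 * (J (u n) - d)"
        by (rule parallelogram)
      also have "\<dots> < 2 * (e\<^sup>2 / 4) + 2 * (e\<^sup>2 / 4)"
        using J_small that by (intro add_strict_mono mult_strict_left_mono) auto
      finally have "(norm (u m - u n))\<^sup>2 < e\<^sup>2" by simp
      then show ?thesis
        using e by (simp add: dist_norm power2_less_imp_less)
    qed
    then show "\<exists>N. \<forall>m\<ge>N. \<forall>n\<ge>N. dist (u m) (u n) < e" by blast
  qed
  then obtain v where v: "u \<longlonglongrightarrow> v"
    using Cauchy_convergent_iff convergent_def by blast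
  have "(\<lambda>n. J (u n)) \<longlonglongrightarrow> J v"
    unfolding J_def by (intro tendsto_intros \<phi>.tendsto v)
  moreover have "(\<lambda>n. J (u n)) \<longlonglongrightarrow> d"
  proof (rule tendsto_sandwich[where f = "\<lambda>_. d"])
    show "(\<lambda>n. d + inverse (real (Suc n))) \<longlonglongrightarrow> d"
      using LIMSEQ_inverse_real_of_nat_add by simp
    show "\<forall>\<^sub>F n in sequentially. J (u n) \<le> d + inverse (real (Suc n))"
      using u by (auto intro: always_eventually less_imp_le)
  qed (auto simp: d_le)
  ultimately have Jv: "J v = d" by (rule LIMSEQ_unique)
  \<comment> \<open>Vary \<open>J\<close> at its minimiser in the direction of \<open>x\<close>, with the phase of the defect \<open>s\<close>.\<close>
  have "\<phi> x = cinner x v" for x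
  proof -
    define s where "s = \<phi> x - cinner x v"
    have var: "2 * r * (cmod s)\<^sup>2 \<le> r\<^sup>2 * ((cmod s)\<^sup>2 * (norm x)\<^sup>2)" for r :: real
    proof -
      let ?y = "(of_real r * cnj s) *\<^sub>C x"
      have "J (v + ?y) = J v + 2 * Re (cinner ?y v) + (norm ?y)\<^sup>2 - 2 * Re (\<phi> ?y)"
        using norm_add_sq[of ?y v] by (simp add: J_def \<phi>.add add.commute)
      also have "\<dots> = J v - 2 * Re (\<phi> ?y - cinner ?y v) + (norm ?y)\<^sup>2"
        by simp
      also have "\<phi> ?y - cinner ?y v = of_real r * (cnj s * s)"
        by (simp only: \<phi>_scale cinner_scaleC_left right_diff_distrib[symmetric] s_def[symmetric]
            mult.assoc)
      also have "of_real r * (cnj s * s) = of_real (r * (cmod s)\<^sup>2)"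
        by (simp only: of_real_mult complex_norm_square mult.commute[of "cnj s"])
      also have "(norm ?y)\<^sup>2 = r\<^sup>2 * ((cmod s)\<^sup>2 * (norm x)\<^sup>2)"
        by (simp add: norm_scaleC norm_mult power_mult_distrib)
      finally show ?thesis using d_le[of "v + ?y"] Jv by simp
    qed
    have "s = 0"
    proof (rule ccontr)
      assume "s \<noteq> 0"
      then have s: "(cmod s)\<^sup>2 > 0" by simp
      \<comment> \<open>Small enough for the linear term to dominate; the summand 1 covers \<open>x = 0\<close>.\<close>
      define r where "r = 1 / ((norm x)\<^sup>2 + 1)"
      have r: "r > 0" "r * (norm x)\<^sup>2 < 1"
        unfolding r_def by (auto simp: add_nonneg_pos add_pos_nonneg divide_less_eq)
      have "2 * (r * (cmod s)\<^sup>2) \<le> (r * (norm x)\<^sup>2) * (r * (cmod s)\<^sup>2)"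
        using var[of r] by (simp add: power2_eq_square algebra_simps)
      also have "\<dots> \<le> 1 * (r * (cmod s)\<^sup>2)"
        using r s by (intro mult_right_mono) auto
      finally show False using r s by simp
    qed
    then show ?thesis by (simp add: s_def)
  qed
  then show ?thesis by blast
qed

text \<open>Apply the Riesz representation theorem to the functionals \<open>y \<mapsto> cnj (q x y)\<close>.\<close>

lemma bounded_form_operator:
  fixes q :: "'a::complex_hilbert \<Rightarrow> 'a \<Rightarrow> complex"
  assumes add1: "\<And>x y z. q (x + y) z = q x z + q y z"
    and scale1: "\<And>c x z. q (c *\<^sub>C x) z = c * q x z"
    and add2: "\<And>x y z. q z (x + y) = q z x + q z y"
    and scale2: "\<And>c x z. q z (c *\<^sub>C x) = cnj c * q z x"
    and bound: "\<And>x y. cmod (q x y) \<le> K * norm x * norm y"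
  shows "\<exists>A. bounded_clinear A \<and> (\<forall>x y. cinner (A x) y = q x y)"
proof -
  have "\<exists>v. \<forall>y. cnj (q x y) = cinner y v" for x
  proof (rule Riesz_representation, rule bounded_clinearI)
    show "norm (cnj (q x y)) \<le> norm y * (K * norm x)" for y
      using bound[of x y] by (simp add: mult_ac)
  qed (simp_all add: add2 scale2 scaleC_complex_def)
  then obtain A where A0: "\<And>x y. cnj (q x y) = cinner y (A x)" by metis
  have A: "cinner (A x) y = q x y" for x y
    using A0[of x y] cinner_commute[of "A x" y] by (simp flip: A0)
  have "bounded_clinear A"
  proof (rule bounded_clinearI)
    show "A (x + y) = A x + A y" for x y
      by (rule cinner_eqI) (simp add: A add1 cinner_add_left)
    show "A (c *\<^sub>C x) = c *\<^sub>C A x" for c x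
      by (rule cinner_eqI) (simp add: A scale1 cinner_scaleC_left)
    show "norm (A x) \<le> norm x * K" for x
    proof (cases "A x = 0")
      case True
      have "0 \<le> K * norm x * norm x"
        using bound[of x x] norm_ge_zero order_trans by blast
      then have "0 \<le> K * norm x"
        by (cases "x = 0") (simp_all add: zero_le_mult_iff)
      then show ?thesis using True by (simp add: mult.commute)
    next
      case False
      have "norm (A x) * norm (A x) = cmod (q x (A x))"
        by (simp add: cinner_self norm_mult power2_eq_square flip: A)
      also have "\<dots> \<le> (norm x * K) * norm (A x)"
        using bound[of x "A x"] by (simp add: mult_ac)
      finally show ?thesis using False by simp
    qed
  qed
  then show ?thesis using A by blast
qed

lemma adjoint_exists:
  fixes A :: "'a::complex_hilbert \<Rightarrow> 'a"
  assumes A: "bounded_clinear A"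
  shows "\<exists>B. bounded_clinear B \<and> (\<forall>x y. cinner (B x) y = cinner x (A y))"
proof -
  obtain K where K: "\<And>x. norm (A x) \<le> norm x * K"
    using bounded_linear.bounded[OF bounded_clinear_linear[OF A]] by blast
  show ?thesis
  proof (rule bounded_form_operator)
    show "cmod (cinner x (A y)) \<le> K * norm x * norm y" for x y
    proof -
      have "norm x * norm (A y) \<le> norm x * (norm y * K)"
        using K by (intro mult_left_mono) auto
      then show ?thesis using Cauchy_Schwarz[of x "A y"] by (simp add: mult_ac)
    qed
  qed (simp_all add: cinner_add_left cinner_add_right cinner_scaleC_left cinner_scaleC_right
      bounded_clinear_add bounded_clinear_scaleC A)
qed

section \<open>Positive operators\<close>

lemma positive_op_bounded: "positive_op P \<Longrightarrow> bounded_clinear P"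
  and positive_op_nonneg: "positive_op P \<Longrightarrow> Re (cinner (P x) x) \<ge> 0"
  and positive_op_real: "positive_op P \<Longrightarrow> cinner (P x) x = of_real (Re (cinner (P x) x))"
  by (auto simp: positive_op_def nonneg_Reals_def complex_eq_iff elim!: allE[of _ x] Reals_cases)

lemma positive_opI:
  assumes "bounded_clinear P"
    and "\<And>x. \<exists>r\<ge>0. cinner (P x) x = complex_of_real r"
  shows "positive_op P"
  using assms by (fastforce simp: positive_op_def nonneg_Reals_def)

text \<open>A sesquilinear form with a real diagonal is hermitian: polarise with \<open>x + y\<close> and with
  \<open>x + \<i> y\<close>.\<close>

lemma positive_op_selfadjoint:
  fixes P :: "'a::complex_hilbert \<Rightarrow> 'a"
  assumes P: "positive_op P"
  shows "cinner (P x) y = cinner x (P y)"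
proof -
  note lin = bounded_clinear_add[OF positive_op_bounded[OF P]]
    bounded_clinear_scaleC[OF positive_op_bounded[OF P]]
  have real: "Im (cinner (P z) z) = 0" for z
    using arg_cong[OF positive_op_real[OF P, of z], of Im] by simp
  have "Im (cinner (P x) y) + Im (cinner (P y) x) = 0"
    using real[of "x + y"] real[of x] real[of y]
    by (simp add: lin cinner_add_left cinner_add_right)
  moreover have "Re (cinner (P y) x) = Re (cinner (P x) y)"
    using real[of "x + \<i> *\<^sub>C y"] real[of x] real[of y]
    by (simp add: lin cinner_add_left cinner_add_right cinner_scaleC_left cinner_scaleC_right)
  ultimately have "cinner (P x) y = cnj (cinner (P y) x)"
    by (simp add: complex_eq_iff)
  also have "\<dots> = cinner x (P y)"
    by (rule cinner_commute[symmetric])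
  finally show ?thesis .
qed

lemma positive_op_square:
  fixes S :: "'a::complex_hilbert \<Rightarrow> 'a"
  assumes S: "bounded_clinear S" and sa: "\<And>x y. cinner (S x) y = cinner x (S y)"
  shows "positive_op (\<lambda>x. S (S x))"
proof (rule positive_opI)
  fix x
  have "cinner (S (S x)) x = of_real ((norm (S x))\<^sup>2)"
    by (simp add: sa[of "S x"] cinner_self)
  then show "\<exists>r\<ge>0. cinner (S (S x)) x = complex_of_real r"
    by (meson zero_le_power2)
qed (rule bounded_clinear_compose[OF S S])

lemma positive_op_Cauchy_Schwarz:
  fixes P :: "'a::complex_hilbert \<Rightarrow> 'a"
  assumes P: "positive_op P"
  shows "(cmod (cinner (P x) y))\<^sup>2 \<le> Re (cinner (P x) x) * Re (cinner (P y) y)"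
proof (rule form_Cauchy_Schwarz)
  show "cinner (P x) y = cnj (cinner (P y) x)" for x y
    unfolding positive_op_selfadjoint[OF P, of x y] by (rule cinner_commute)
qed (simp_all add: bounded_clinear_add bounded_clinear_scaleC positive_op_bounded[OF P]
    cinner_add_left cinner_scaleC_left positive_op_nonneg[OF P])

text \<open>The Cauchy-Schwarz inequality for the form of \<open>P\<close>, at the pair of \<open>x\<close> and \<open>P x\<close>. With
  \<open>K = 1\<close> it says \<open>P\<^sup>2 \<le> P\<close> for contractions.\<close>

lemma positive_op_norm_bound:
  fixes P :: "'a::complex_hilbert \<Rightarrow> 'a"
  assumes P: "positive_op P" and K: "\<And>x. norm (P x) \<le> K * norm x"
  shows "(norm (P x))\<^sup>2 \<le> K * Re (cinner (P x) x)"
proof (cases "P x = 0")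
  case True
  then show ?thesis by (simp add: cinner.zero_left)
next
  case False
  let ?n = "(norm (P x))\<^sup>2"
  have "?n * ?n = (cmod (cinner (P x) (P x)))\<^sup>2"
    by (simp add: cinner_self norm_power power2_eq_square norm_mult)
  also have "\<dots> \<le> Re (cinner (P x) x) * Re (cinner (P (P x)) (P x))"
    by (rule positive_op_Cauchy_Schwarz[OF P])
  also have "\<dots> \<le> Re (cinner (P x) x) * (K * ?n)"
  proof (rule mult_left_mono)
    have "Re (cinner (P (P x)) (P x)) \<le> norm (P (P x)) * norm (P x)"
      using Cauchy_Schwarz complex_Re_le_cmod order_trans by blast
    also have "\<dots> \<le> K * norm (P x) * norm (P x)"
      by (intro mult_right_mono K) simp
    finally show "Re (cinner (P (P x)) (P x)) \<le> K * ?n"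
      by (simp add: power2_eq_square mult.assoc)
  qed (rule positive_op_nonneg[OF P])
  finally have "?n * ?n \<le> (K * Re (cinner (P x) x)) * ?n" by (simp add: mult_ac)
  then show ?thesis by (rule mult_right_le_imp_le) (use False in simp)
qed

lemma positive_op_eq_zero:
  fixes P :: "'a::complex_hilbert \<Rightarrow> 'a"
  assumes P: "positive_op P" and 0: "Re (cinner (P x) x) = 0"
  shows "P x = 0"
proof -
  have "cinner (P x) (P x) = 0"
    using positive_op_Cauchy_Schwarz[OF P, of x "P x"] 0 by simp
  then show ?thesis by simp
qed

section \<open>Square roots of positive operators\<close>

text \<open>With \<open>B = 1 - A\<close>, the root \<open>P\<close> of \<open>A\<close> is \<open>1 - Y\<close> for a solution \<open>Y\<close> of \<open>Y = (B + Y\<^sup>2) / 2\<close>, which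
  \<open>sqrt_iterate\<close> approximates by iteration from \<open>0\<close>. The numbers \<open>sqrt_majorant n\<close> are the
  same iteration for the scalar \<open>B = 1\<close>. The iterates are polynomials in \<open>B\<close> with nonnegative
  coefficients, and so are their successive differences; therefore the scalar iteration bounds both in norm whenever \<open>\<parallel>B\<parallel> \<le> 1\<close>.\<close>

fun sqrt_majorant :: "nat \<Rightarrow> real" where
  "sqrt_majorant 0 = 0"
| "sqrt_majorant (Suc n) = (1 + (sqrt_majorant n)\<^sup>2) / 2"

fun sqrt_iterate :: "('a::complex_hilbert \<Rightarrow>\<^sub>L 'a) \<Rightarrow> nat \<Rightarrow> 'a \<Rightarrow>\<^sub>L 'a" where
  "sqrt_iterate B 0 = 0"
| "sqrt_iterate B (Suc n) = (1/2) *\<^sub>R (B + (sqrt_iterate B n o\<^sub>L sqrt_iterate B n))"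

lemma sqrt_majorant_bounds: "0 \<le> sqrt_majorant n" "sqrt_majorant n \<le> 1"
proof -
  have "0 \<le> sqrt_majorant n \<and> sqrt_majorant n \<le> 1"
    by (induction n) (auto simp: abs_square_le_1 abs_le_iff)
  then show "0 \<le> sqrt_majorant n" "sqrt_majorant n \<le> 1" by auto
qed

lemma sqrt_majorant_mono: "sqrt_majorant n \<le> sqrt_majorant (Suc n)"
proof -
  have "0 \<le> (1 - sqrt_majorant n)\<^sup>2" by simp
  then show ?thesis by (simp add: power2_diff)
qed

lemma sqrt_majorant_convergent: "convergent sqrt_majorant"
  by (rule Bseq_mono_convergent[OF BseqI'[where K = 1]])
    (auto simp: sqrt_majorant_bounds intro: lift_Suc_mono_le[of sqrt_majorant, OF sqrt_majorant_mono])

lemma sqrt_iterate_commute: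
  assumes "Q o\<^sub>L B = B o\<^sub>L Q"
  shows "Q o\<^sub>L sqrt_iterate B n = sqrt_iterate B n o\<^sub>L Q"
proof (induction n)
  case 0
  then show ?case by (simp add: blinfun_compose_zero)
next
  case (Suc n)
  interpret comp: bounded_bilinear "(o\<^sub>L) :: ('a \<Rightarrow>\<^sub>L 'a) \<Rightarrow> ('a \<Rightarrow>\<^sub>L 'a) \<Rightarrow> ('a \<Rightarrow>\<^sub>L 'a)"
    by (rule bounded_bilinear_blinfun_compose)
  let ?Y = "sqrt_iterate B n"
  have IH: "Q (?Y x) = ?Y (Q x)" for x
    using arg_cong[OF Suc.IH, of "\<lambda>Z. blinfun_apply Z x"] by simp
  have "Q o\<^sub>L (?Y o\<^sub>L ?Y) = (?Y o\<^sub>L ?Y) o\<^sub>L Q"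
    by (rule blinfun_eqI) (simp add: IH)
  then show ?case
    using assms by (simp add: comp.add_left comp.add_right comp.scaleR_left comp.scaleR_right)
qed

lemma sqrt_iterate_norm:
  assumes "norm B \<le> 1"
  shows "norm (sqrt_iterate B n) \<le> sqrt_majorant n"
proof (induction n)
  case (Suc n)
  let ?Y = "sqrt_iterate B n"
  have "norm (?Y o\<^sub>L ?Y) \<le> norm ?Y * norm ?Y"
    by (rule norm_blinfun_compose)
  also have "\<dots> \<le> sqrt_majorant n * sqrt_majorant n"
    using Suc.IH by (intro mult_mono) (auto simp: sqrt_majorant_bounds)
  finally have "norm (B + (?Y o\<^sub>L ?Y)) \<le> 1 + (sqrt_majorant n)\<^sup>2"
    using assms norm_triangle_ineq[of B "?Y o\<^sub>L ?Y"] by (simp add: power2_eq_square)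
  then show ?case by simp
qed simp

text \<open>Since the iterates commute, \<open>Z\<^sup>2 - Y\<^sup>2 = (Z + Y) (Z - Y)\<close>, and the scalar iteration satisfies the
  same identity with equality in the norm estimates.\<close>

lemma sqrt_iterate_step:
  assumes "norm B \<le> 1"
  shows "norm (sqrt_iterate B (Suc n) - sqrt_iterate B n) \<le> sqrt_majorant (Suc n) - sqrt_majorant n"
proof (induction n)
  case 0
  then show ?case using assms by (simp add: blinfun_compose_zero)
next
  case (Suc n)
  interpret comp: bounded_bilinear "(o\<^sub>L) :: ('a \<Rightarrow>\<^sub>L 'a) \<Rightarrow> ('a \<Rightarrow>\<^sub>L 'a) \<Rightarrow> ('a \<Rightarrow>\<^sub>L 'a)"
    by (rule bounded_bilinear_blinfun_compose)
  let ?Y = "sqrt_iterate B n" and ?Z = "sqrt_iterate B (Suc n)"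
  let ?y = "sqrt_majorant n" and ?z = "sqrt_majorant (Suc n)"
  have comm: "?Y o\<^sub>L ?Z = ?Z o\<^sub>L ?Y"
    by (intro sqrt_iterate_commute sqrt_iterate_commute[symmetric]) simp
  have "sqrt_iterate B (Suc (Suc n)) - ?Z = (1/2) *\<^sub>R ((?Z o\<^sub>L ?Z) - (?Y o\<^sub>L ?Y))"
    unfolding sqrt_iterate.simps(2)[of B "Suc n"]
    by (subst (3) sqrt_iterate.simps(2)) (simp add: scaleR_diff_right scaleR_add_right del: sqrt_iterate.simps)
  also have "(?Z o\<^sub>L ?Z) - (?Y o\<^sub>L ?Y) = (?Z + ?Y) o\<^sub>L (?Z - ?Y)"
    by (simp add: comp.add_left comp.diff_right comm del: sqrt_iterate.simps)
  finally have "norm (sqrt_iterate B (Suc (Suc n)) - ?Z)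
      = norm ((?Z + ?Y) o\<^sub>L (?Z - ?Y)) / 2" by (simp del: sqrt_iterate.simps)
  also have "\<dots> \<le> (?z + ?y) * (?z - ?y) / 2"
  proof -
    have "norm ((?Z + ?Y) o\<^sub>L (?Z - ?Y)) \<le> norm (?Z + ?Y) * norm (?Z - ?Y)"
      by (rule norm_blinfun_compose)
    also have "\<dots> \<le> (?z + ?y) * (?z - ?y)"
      by (intro mult_mono Suc.IH order_trans[OF norm_triangle_ineq] add_mono
          sqrt_iterate_norm[OF assms] add_nonneg_nonneg sqrt_majorant_bounds norm_ge_zero)
    finally show ?thesis by simp
  qed
  also have "\<dots> = sqrt_majorant (Suc (Suc n)) - ?z"
    unfolding sqrt_majorant.simps(2)[of "Suc n"] sqrt_majorant.simps(2)[of n]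
    by (simp add: field_simps power2_eq_square)
  finally show ?case .
qed

text \<open>The bounds for the steps telescope, and the scalar iteration converges. So the iteration
  converges in norm although \<open>\<parallel>B\<parallel> = 1\<close> is permitted.\<close>

lemma sqrt_iterate_convergent:
  assumes "norm B \<le> 1"
  shows "convergent (sqrt_iterate B)"
proof -
  have "summable (\<lambda>n. sqrt_majorant (Suc n) - sqrt_majorant n)"
    using sqrt_majorant_convergent by (auto simp: convergent_def simp del: sqrt_majorant.simps intro: telescope_summable)
  then have "summable (\<lambda>n. sqrt_iterate B (Suc n) - sqrt_iterate B n)"
    by (rule summable_comparison_test'[where N = 0]) (rule sqrt_iterate_step[OF assms])
  then have "convergent (\<lambda>n. \<Sum>i<n. sqrt_iterate B (Suc i) - sqrt_iterate B i)"
    by (simp add: summable_iff_convergent)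
  then show ?thesis
    by (simp add: sum_lessThan_telescope del: sqrt_iterate.simps(2))
qed

lemma sqrt_iterate_selfadjoint:
  fixes B :: "'a::complex_hilbert \<Rightarrow>\<^sub>L 'a"
  assumes "\<And>x y. cinner (B x) y = cinner x (B y)"
  shows "cinner (sqrt_iterate B n x) y = cinner x (sqrt_iterate B n y)"
  using assms
  by (induction n arbitrary: x y)
    (simp_all add: blinfun.zero_left blinfun.scaleR_left blinfun.add_left cinner_scaleR_left
      cinner_scaleR_right cinner_add_left cinner_add_right cinner.zero_left cinner.zero_right)

text \<open>The commutation clause is the reason why the root is constructed as a limit of polynomials: it
  yields uniqueness of the root and, applied to scalar multiplications, its complex linearity.\<close>

lemma contraction_sqrt_exists:
  fixes A :: "'a::complex_hilbert \<Rightarrow> 'a"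
  assumes A: "positive_op A" and contr: "\<And>x. norm (A x) \<le> norm x"
  shows "\<exists>P. positive_op P \<and> (\<forall>x. P (P x) = A x) \<and>
    (\<forall>Q. bounded_clinear Q \<longrightarrow> (\<forall>x. Q (A x) = A (Q x)) \<longrightarrow> (\<forall>x. Q (P x) = P (Q x)))"
proof -
  interpret comp: bounded_bilinear "(o\<^sub>L) :: ('a \<Rightarrow>\<^sub>L 'a) \<Rightarrow> ('a \<Rightarrow>\<^sub>L 'a) \<Rightarrow> ('a \<Rightarrow>\<^sub>L 'a)"
    by (rule bounded_bilinear_blinfun_compose)
  have bA: "bounded_clinear A" using A by (rule positive_op_bounded)
  define B where "B = Blinfun (\<lambda>x. x - A x)"
  have B: "blinfun_apply B x = x - A x" for x
    using bounded_clinear_linear[OF bA]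
    by (simp add: B_def bounded_linear_Blinfun_apply bounded_linear_sub bounded_linear_ident)
  \<comment> \<open>\<open>\<parallel>B x\<parallel>\<^sup>2 = \<parallel>x\<parallel>\<^sup>2 - 2 \<langle>A x, x\<rangle> + \<parallel>A x\<parallel>\<^sup>2\<close>, and the last term is at most \<open>\<langle>A x, x\<rangle>\<close>.\<close>
  have "norm (B x) \<le> norm x" for x
  proof -
    have "(norm (A x))\<^sup>2 \<le> Re (cinner (A x) x)"
      using positive_op_norm_bound[OF A, of 1] contr by simp
    moreover have "Re (cinner x (A x)) = Re (cinner (A x) x)"
      by (simp add: positive_op_selfadjoint[OF A])
    ultimately have "(norm (B x))\<^sup>2 \<le> (norm x)\<^sup>2"
      using positive_op_nonneg[OF A, of x] by (simp add: B norm_diff_sq)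
    then show ?thesis by (rule power2_le_imp_le) simp
  qed
  then have B1: "norm B \<le> 1" by (intro norm_blinfun_bound) auto
  have B_sa: "cinner (B x) y = cinner x (B y)" for x y
    by (simp add: B cinner.diff_left cinner.diff_right positive_op_selfadjoint[OF A])
  obtain Y where Y: "sqrt_iterate B \<longlonglongrightarrow> Y"
    using sqrt_iterate_convergent[OF B1] by (auto simp: convergent_def)
  have Y_eq: "Y = (1/2) *\<^sub>R (B + (Y o\<^sub>L Y))"
  proof (rule LIMSEQ_unique)
    show "(\<lambda>n. sqrt_iterate B (Suc n)) \<longlonglongrightarrow> Y" using Y by (rule LIMSEQ_Suc)
    show "(\<lambda>n. sqrt_iterate B (Suc n)) \<longlonglongrightarrow> (1/2) *\<^sub>R (B + (Y o\<^sub>L Y))"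
      unfolding sqrt_iterate.simps by (intro tendsto_intros comp.tendsto Y)
  qed
  have Y_norm: "norm Y \<le> 1"
    using sqrt_iterate_norm[OF B1] sqrt_majorant_bounds(2)
    by (intro LIMSEQ_le_const2[OF tendsto_norm[OF Y]]) (blast intro: order_trans)
  have Y_app: "(\<lambda>n. sqrt_iterate B n x) \<longlonglongrightarrow> Y x" for x
    by (intro tendsto_intros Y)
  have Y_sa: "cinner (Y x) y = cinner x (Y y)" for x y
  proof (rule LIMSEQ_unique)
    show "(\<lambda>n. cinner (sqrt_iterate B n x) y) \<longlonglongrightarrow> cinner (Y x) y"
      by (intro cinner.tendsto tendsto_const Y_app)
    show "(\<lambda>n. cinner (sqrt_iterate B n x) y) \<longlonglongrightarrow> cinner x (Y y)"
      unfolding sqrt_iterate_selfadjoint[OF B_sa] by (intro cinner.tendsto tendsto_const Y_app)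
  qed
  have Y_comm: "Q (Y x) = Y (Q x)"
    if Q: "bounded_linear Q" "\<And>x. Q (A x) = A (Q x)" for Q x
  proof -
    let ?Q = "Blinfun Q"
    have app: "blinfun_apply ?Q = Q" using Q(1) by (rule bounded_linear_Blinfun_apply)
    have "?Q o\<^sub>L B = B o\<^sub>L ?Q"
      by (rule blinfun_eqI) (simp add: app B Q(2) bounded_linear.linear[OF Q(1)] linear_diff)
    then have "?Q o\<^sub>L sqrt_iterate B n = sqrt_iterate B n o\<^sub>L ?Q" for n
      by (rule sqrt_iterate_commute)
    moreover have "(\<lambda>n. ?Q o\<^sub>L sqrt_iterate B n) \<longlonglongrightarrow> (?Q o\<^sub>L Y)"
      "(\<lambda>n. sqrt_iterate B n o\<^sub>L ?Q) \<longlonglongrightarrow> (Y o\<^sub>L ?Q)"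
      by (intro comp.tendsto tendsto_const Y)+
    ultimately have "?Q o\<^sub>L Y = Y o\<^sub>L ?Q"
      using LIMSEQ_unique by simp
    then show ?thesis
      by (metis app blinfun_apply_blinfun_compose)
  qed
  define P where "P x = x - Y x" for x
  \<comment> \<open>Operators of type \<open>\<Rightarrow>\<^sub>L\<close> are only real linear.\<close>
  have "Y (c *\<^sub>C x) = c *\<^sub>C Y x" for c x
    by (rule Y_comm[symmetric]) (simp_all add: bounded_linear_scaleC bounded_clinear_scaleC[OF bA])
  then have bP: "bounded_clinear P"
    unfolding P_def
    by (intro bounded_clinear_diff bounded_clinear_id)
      (simp add: bounded_clinear_def blinfun.bounded_linear_right)
  have "positive_op P"
  proof (rule positive_opI[OF bP])
    fix x
    have "cinner (Y x) x = cnj (cinner (Y x) x)"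
      using Y_sa[of x x] cinner_commute[of x "Y x"] by simp
    then have Im: "Im (cinner (Y x) x) = 0" by (simp add: complex_eq_iff)
    have "Re (cinner (Y x) x) \<le> norm (Y x) * norm x"
      using Cauchy_Schwarz complex_Re_le_cmod order_trans by blast
    also have "norm (Y x) \<le> norm x"
      using norm_blinfun[of Y x] Y_norm mult_right_mono[OF Y_norm, of "norm x"] by simp
    finally have "0 \<le> (norm x)\<^sup>2 - Re (cinner (Y x) x)"
      by (simp add: power2_eq_square mult_right_mono)
    moreover have "cinner (P x) x = of_real ((norm x)\<^sup>2 - Re (cinner (Y x) x))"
      by (simp add: P_def cinner.diff_left cinner_self complex_eq_iff Im)
    ultimately show "\<exists>r\<ge>0. cinner (P x) x = complex_of_real r" by blast
  qed
  moreover have "P (P x) = A x" for x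
  proof -
    have "blinfun_apply Y x = (1/2) *\<^sub>R (x - A x + Y (Y x))"
      by (subst Y_eq) (simp add: blinfun.scaleR_left blinfun.add_left B)
    then have "2 *\<^sub>R Y x = 2 *\<^sub>R (1/2) *\<^sub>R (x - A x + Y (Y x))" by (rule arg_cong)
    also have "\<dots> = x - A x + Y (Y x)" by simp
    finally have "2 *\<^sub>R Y x = x - A x + Y (Y x)" .
    then show ?thesis
      by (simp add: P_def blinfun.diff_right algebra_simps scaleR_2)
  qed
  moreover have "Q (P x) = P (Q x)" if "bounded_clinear Q" "\<forall>x. Q (A x) = A (Q x)" for Q x
    using Y_comm[of Q x] that by (simp add: P_def bounded_clinear_def linear_diff bounded_linear.linear)
  ultimately show ?thesis by blast
qed

lemma positive_sqrt_exists:
  fixes A :: "'a::complex_hilbert \<Rightarrow> 'a"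
  assumes A: "positive_op A"
  shows "\<exists>P. positive_op P \<and> (\<forall>x. P (P x) = A x) \<and>
    (\<forall>Q. bounded_clinear Q \<longrightarrow> (\<forall>x. Q (A x) = A (Q x)) \<longrightarrow> (\<forall>x. Q (P x) = P (Q x)))"
proof -
  obtain K where K: "K > 0" "\<And>x. norm (A x) \<le> norm x * K"
    using bounded_linear.pos_bounded[OF bounded_clinear_linear[OF positive_op_bounded[OF A]]] by blast
  have scale: "positive_op (\<lambda>x. of_real c *\<^sub>C P x)" if "positive_op P" "c \<ge> 0"
    for c :: real and P :: "'a \<Rightarrow> 'a"
  proof (rule positive_opI)
    fix x
    show "\<exists>r\<ge>0. cinner (complex_of_real c *\<^sub>C P x) x = complex_of_real r"
      using positive_op_real[OF that(1), of x] positive_op_nonneg[OF that(1), of x] that(2)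
      by (intro exI[of _ "c * Re (cinner (P x) x)"]) (simp add: cinner_scaleC_left)
  qed (intro bounded_clinear_scale positive_op_bounded that)
  define A' where "A' x = of_real (1/K) *\<^sub>C A x" for x
  have "positive_op A'"
    unfolding A'_def using A K by (intro scale) auto
  moreover have "norm (A' x) \<le> norm x" for x
    using K(2)[of x] K(1) by (simp add: A'_def norm_scaleC norm_divide field_simps)
  ultimately obtain P where P: "positive_op P" "\<And>x. P (P x) = A' x"
    and comm: "\<And>Q x. bounded_clinear Q \<Longrightarrow> (\<And>x. Q (A' x) = A' (Q x)) \<Longrightarrow> Q (P x) = P (Q x)"
    using contraction_sqrt_exists[of A'] by metis
  have "positive_op (\<lambda>x. of_real (sqrt K) *\<^sub>C P x)"
    using P(1) K by (intro scale) auto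
  moreover have "of_real (sqrt K) *\<^sub>C P (of_real (sqrt K) *\<^sub>C P x) = A x" for x
  proof -
    have "of_real (sqrt K) *\<^sub>C P (of_real (sqrt K) *\<^sub>C P x) = of_real (sqrt K * sqrt K) *\<^sub>C A' x"
      by (simp only: bounded_clinear_scaleC[OF positive_op_bounded[OF P(1)]] P(2) scaleC_scaleC
          of_real_mult)
    also have "\<dots> = of_real (K * (1 / K)) *\<^sub>C A x"
      using K by (simp add: A'_def scaleC_scaleC)
    finally show ?thesis using K by simp
  qed
  moreover have "Q (of_real (sqrt K) *\<^sub>C P x) = of_real (sqrt K) *\<^sub>C P (Q x)"
    if Q: "bounded_clinear Q" "\<And>x. Q (A x) = A (Q x)" for Q x
    using comm[OF Q(1)] by (simp add: A'_def bounded_clinear_scaleC[OF Q(1)] Q(2))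
  ultimately show ?thesis by blast
qed

text \<open>If \<open>R\<close> and \<open>S\<close> commute and have the same square, then \<open>(R + S) (R - S) = 0\<close>. So with
  \<open>y = R x - S x\<close> both \<open>\<langle>R y, y\<rangle>\<close> and \<open>\<langle>S y, y\<rangle>\<close> vanish, hence \<open>R y = S y = 0\<close> and
  \<open>\<parallel>y\<parallel>\<^sup>2 = \<langle>x, (R - S) y\<rangle> = 0\<close>.\<close>

lemma positive_sqrt_unique:
  fixes P Q :: "'a::complex_hilbert \<Rightarrow> 'a"
  assumes P: "positive_op P" and Q: "positive_op Q" and eq: "\<And>x. P (P x) = Q (Q x)"
  shows "P = Q"
proof -
  have *: "R = S" if R: "positive_op R" and S: "positive_op S" and sq: "\<And>x. R (R x) = S (S x)"
    and RS: "\<And>x. R (S x) = S (R x)" for R S :: "'a \<Rightarrow> 'a"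
  proof
    fix x
    interpret R: bounded_linear R by (intro bounded_clinear_linear positive_op_bounded R)
    interpret S: bounded_linear S by (intro bounded_clinear_linear positive_op_bounded S)
    define y where "y = R x - S x"
    have "R y + S y = 0"
      by (simp add: y_def R.diff S.diff sq RS)
    then have "cinner (R y) y + cinner (S y) y = 0"
      by (metis cinner_add_left cinner.zero_left)
    then have "Re (cinner (R y) y) = 0" "Re (cinner (S y) y) = 0"
      using positive_op_nonneg[OF R, of y] positive_op_nonneg[OF S, of y]
      by (simp_all add: complex_eq_iff)
    then have "R y = 0" "S y = 0"
      using positive_op_eq_zero R S by blast+
    moreover have "cinner y y = cinner x (R y) - cinner x (S y)"
      by (simp add: y_def cinner.diff_left positive_op_selfadjoint[OF R] positive_op_selfadjoint[OF S])
    ultimately have "y = 0" by (simp add: cinner.zero_right)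
    then show "R x = S x" by (simp add: y_def)
  qed
  \<comment> \<open>Compare both with the root that commutes with the whole commutant of \<open>P P\<close>, hence with
    \<open>P\<close> and with \<open>Q\<close>.\<close>
  obtain R where R: "positive_op R" "\<And>x. R (R x) = P (P x)"
    and comm: "\<And>C x. bounded_clinear C \<Longrightarrow> (\<And>x. C (P (P x)) = P (P (C x))) \<Longrightarrow> C (R x) = R (C x)"
    using positive_sqrt_exists[OF positive_op_square[OF positive_op_bounded[OF P]
        positive_op_selfadjoint[OF P]]] by metis
  have "R = P"
    using comm[OF positive_op_bounded[OF P]] by (intro * R P) (simp_all add: R)
  moreover have "R = Q"
    using comm[OF positive_op_bounded[OF Q]] by (intro * R Q) (simp_all add: R eq)
  ultimately show ?thesis by simp
qed

section \<open>The modulus of an operator\<close>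

lemma abs_op_eqI:
  fixes A :: "'a::complex_hilbert \<Rightarrow> 'a"
  assumes P: "positive_op P" and PP: "\<And>x y. cinner (P (P x)) y = cinner (A x) (A y)"
  shows "abs_op A = P"
  unfolding abs_op_def
proof (rule the_equality)
  show "Q = P" if Q: "positive_op Q \<and> (\<forall>x y. cinner (Q (Q x)) y = cinner (A x) (A y))" for Q
  proof (rule positive_sqrt_unique)
    show "Q (Q x) = P (P x)" for x
      by (rule cinner_eqI) (use Q PP in simp)
  qed (use Q P in auto)
qed (use P PP in blast)

text \<open>The root of \<open>A\<^sup>* A\<close>, which is positive because \<open>\<langle>A\<^sup>* A x, x\<rangle> = \<parallel>A x\<parallel>\<^sup>2\<close>, meets the description that
  defines the modulus.\<close>

lemma abs_op:
  fixes A :: "'a::complex_hilbert \<Rightarrow> 'a"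
  assumes A: "bounded_clinear A"
  shows positive_op_abs_op: "positive_op (abs_op A)"
    and abs_op_square: "cinner (abs_op A (abs_op A x)) y = cinner (A x) (A y)"
proof -
  obtain A' where A': "bounded_clinear A'" "\<And>x y. cinner (A' x) y = cinner x (A y)"
    using adjoint_exists[OF A] by blast
  have "positive_op (\<lambda>x. A' (A x))"
  proof (rule positive_opI)
    show "\<exists>r\<ge>0. cinner (A' (A x)) x = complex_of_real r" for x
      by (intro exI[of _ "(norm (A x))\<^sup>2"]) (simp add: A' cinner_self)
  qed (rule bounded_clinear_compose[OF A'(1) A])
  then obtain P where P: "positive_op P" "\<And>x. P (P x) = A' (A x)"
    using positive_sqrt_exists by blast
  then have "abs_op A = P"
    by (intro abs_op_eqI) (simp_all add: A')
  then show "positive_op (abs_op A)" "cinner (abs_op A (abs_op A x)) y = cinner (A x) (A y)"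
    using P A' by simp_all
qed

section \<open>Hilbert tensor products\<close>

text \<open>A linear relation with dense domain that does not increase norms is single valued, and its
  closure is the graph of an everywhere defined contraction.\<close>

lemma dense_contraction_extension:
  fixes R :: "'k::complex_hilbert \<Rightarrow> 'l::complex_hilbert \<Rightarrow> bool"
  assumes add: "\<And>u v u' v'. R u v \<Longrightarrow> R u' v' \<Longrightarrow> R (u + u') (v + v')"
    and scale: "\<And>c u v. R u v \<Longrightarrow> R (c *\<^sub>C u) (c *\<^sub>C v)"
    and contr: "\<And>u v. R u v \<Longrightarrow> norm v \<le> norm u"
    and dense: "closure {u. \<exists>v. R u v} = UNIV"
  shows "\<exists>L. bounded_clinear L \<and> (\<forall>u v. R u v \<longrightarrow> L u = v)"
proof -
  define G where "G u v \<longleftrightarrow> (\<exists>a b. (\<forall>n. R (a n) (b n)) \<and> a \<longlonglongrightarrow> u \<and> b \<longlonglongrightarrow> v)" for u v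
  have diff: "R (u - u') (v - v')" if "R u v" "R u' v'" for u v u' v'
    using add[OF that(1) scale[OF that(2), of "-1"]] by simp
  have G_add: "G (u + u') (v + v')" if G: "G u v" "G u' v'" for u v u' v'
  proof -
    obtain a b where ab: "\<forall>n. R (a n) (b n)" "a \<longlonglongrightarrow> u" "b \<longlonglongrightarrow> v"
      using G(1) unfolding G_def by blast
    obtain a' b' where "\<forall>n. R (a' n) (b' n)" "a' \<longlonglongrightarrow> u'" "b' \<longlonglongrightarrow> v'"
      using G(2) unfolding G_def by blast
    with ab show ?thesis
      unfolding G_def
      by (intro exI[of _ "\<lambda>n. a n + a' n"] exI[of _ "\<lambda>n. b n + b' n"])
        (auto intro: add tendsto_add)
  qed
  have G_scale: "G (c *\<^sub>C u) (c *\<^sub>C v)" if G: "G u v" for c u v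
  proof -
    obtain a b where "\<forall>n. R (a n) (b n)" "a \<longlonglongrightarrow> u" "b \<longlonglongrightarrow> v"
      using G unfolding G_def by blast
    then show ?thesis
      unfolding G_def
      by (intro exI[of _ "\<lambda>n. c *\<^sub>C a n"] exI[of _ "\<lambda>n. c *\<^sub>C b n"])
        (auto intro: scale bounded_linear.tendsto[OF bounded_linear_scaleC])
  qed
  have G_contr: "norm v \<le> norm u" if G: "G u v" for u v
  proof -
    obtain a b where "\<forall>n. R (a n) (b n)" "a \<longlonglongrightarrow> u" "b \<longlonglongrightarrow> v"
      using G unfolding G_def by blast
    then show ?thesis
      by (intro LIMSEQ_le[OF tendsto_norm tendsto_norm]) (auto intro: contr)
  qed
  have G_unique: "v = v'" if "G u v" "G u v'" for u v v'
    using G_contr[OF G_add[OF that(1) G_scale[OF that(2), of "-1"]]] by simp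
  have "\<exists>v. G u v" for u
  proof -
    have "u \<in> closure {u. \<exists>v. R u v}" using dense by simp
    then obtain a where a: "\<And>n. \<exists>v. R (a n) v" "a \<longlonglongrightarrow> u"
      unfolding closure_sequential by auto
    then obtain b where b: "\<And>n. R (a n) (b n)" by metis
    have "Cauchy b"
    proof (rule metric_CauchyI)
      fix e :: real assume "e > 0"
      then obtain N where N: "\<forall>m\<ge>N. \<forall>n\<ge>N. dist (a m) (a n) < e"
        using metric_CauchyD[OF LIMSEQ_imp_Cauchy[OF a(2)]] by blast
      have "dist (b m) (b n) \<le> dist (a m) (a n)" for m n
        using contr[OF diff[OF b b]] by (simp add: dist_norm)
      then show "\<exists>N. \<forall>m\<ge>N. \<forall>n\<ge>N. dist (b m) (b n) < e"
        using N by (meson order_le_less_trans)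
    qed
    then obtain v where "b \<longlonglongrightarrow> v"
      using Cauchy_convergent_iff convergent_def by blast
    then show ?thesis unfolding G_def using a b by blast
  qed
  then obtain L where L: "\<And>u. G u (L u)" by metis
  have "bounded_clinear L"
  proof (rule bounded_clinearI)
    show "L (u + u') = L u + L u'" for u u'
      by (intro G_unique[OF L] G_add L)
    show "L (c *\<^sub>C u) = c *\<^sub>C L u" for c u
      by (intro G_unique[OF L] G_scale L)
    show "norm (L u) \<le> norm u * 1" for u
      using G_contr[OF L] by simp
  qed
  moreover have "L u = v" if "R u v" for u v
  proof (rule G_unique[OF L])
    show "G u v" unfolding G_def using that by (intro exI[of _ "\<lambda>_. u"] exI[of _ "\<lambda>_. v"]) auto
  qed
  ultimately show ?thesis by blast
qed

lemma hilbert_tensorD: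
  assumes "hilbert_tensor t"
  shows "t (x + x') y = t x y + t x' y" "t x (y + y') = t x y + t x y'"
    "t (c *\<^sub>C x) y = c *\<^sub>C t x y" "t x (c *\<^sub>C y) = c *\<^sub>C t x y"
    "cinner (t x y) (t x' y') = cinner x x' * cinner y y'"
    "closure (cspan {t x y |x y. True}) = UNIV"
  using assms unfolding hilbert_tensor_def by blast+

lemma hilbert_tensor_flip:
  assumes "hilbert_tensor t"
  shows "hilbert_tensor (\<lambda>y x. t x y)"
proof -
  have "{t x y |y x. True} = {t x y |x y. True}" by blast
  then show ?thesis
    using hilbert_tensorD[OF assms] unfolding hilbert_tensor_def by (simp add: mult.commute)
qed

lemma norm_tensor:
  assumes "hilbert_tensor t"
  shows "norm (t x y) = norm x * norm y"
proof -
  have "(norm (t x y))\<^sup>2 = (norm x)\<^sup>2 * (norm y)\<^sup>2"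
    unfolding Re_cinner_self[of "t x y", symmetric] hilbert_tensorD(5)[OF assms]
    by (simp only: cinner_self of_real_mult[symmetric]
        Re_complex_of_real)
  then show ?thesis by (simp add: power2_eq_iff_nonneg flip: power_mult_distrib)
qed

lemma tensor_op_eqI:
  assumes "hilbert_tensor t" "bounded_clinear A" "bounded_clinear B"
    and "\<And>x y. A (t x y) = B (t x y)"
  shows "A = B"
  using assms by (intro bounded_clinear_eq_on_dense[OF _ _ hilbert_tensorD(6)[OF assms(1)]]) auto

lemma tensor_vector_eqI:
  assumes "hilbert_tensor t" and "\<And>x y. cinner u (t x y) = cinner v (t x y)"
  shows "u = v"
  using assms by (intro cinner_eq_on_dense[OF hilbert_tensorD(6)[OF assms(1)]]) auto

lemma op_tensor_eqI:
  assumes t: "hilbert_tensor t" and C: "bounded_clinear C" "\<And>x y. C (t x y) = t (A x) (B y)"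
  shows "op_tensor t A B = C"
  unfolding op_tensor_def
proof (rule the_equality)
  show "D = C" if D: "bounded_clinear D \<and> (\<forall>x y. D (t x y) = t (A x) (B y))" for D
  proof (rule tensor_op_eqI[OF t])
    show "bounded_clinear D" "bounded_clinear C" using D C(1) by blast+
    show "D (t x y) = C (t x y)" for x y
      unfolding C(2) using D by blast
  qed
qed (use C in blast)

section \<open>Tensor products of bounded operators\<close>

text \<open>The finite sums \<open>u = \<Sum> x\<^sub>i \<otimes> y\<^sub>i\<close> together with \<open>v = \<Sum> A x\<^sub>i \<otimes> y\<^sub>i\<close> and \<open>w = \<Sum> D x\<^sub>i \<otimes> y\<^sub>i\<close>. As a relation,
  this avoids choosing a representation of \<open>u\<close> as a sum of simple tensors.\<close>

inductive tensor_graph ::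
    "('a::complex_hilbert \<Rightarrow> 'b::complex_hilbert \<Rightarrow> 'k::complex_hilbert)
      \<Rightarrow> ('a \<Rightarrow> 'a) \<Rightarrow> ('a \<Rightarrow> 'a) \<Rightarrow> 'k \<Rightarrow> 'k \<Rightarrow> 'k \<Rightarrow> bool"
  for t A D where
  zero: "tensor_graph t A D 0 0 0"
| plus: "tensor_graph t A D u v w \<Longrightarrow>
    tensor_graph t A D (u + t x y) (v + t (A x) y) (w + t (D x) y)"

text \<open>If \<open>x \<mapsto> (A x, D x)\<close> preserves inner products, then so does \<open>u \<mapsto> (v, w)\<close>, by bilinearity. In
  particular \<open>v\<close> is determined by \<open>u\<close> and \<open>\<parallel>v\<parallel> \<le> \<parallel>u\<parallel>\<close>, without any orthogonalisation of
  the \<open>y\<^sub>i\<close>.\<close>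

lemma tensor_graph_isometry:
  assumes t: "hilbert_tensor t"
    and iso: "\<And>x x'. cinner x x' = cinner (A x) (A x') + cinner (D x) (D x')"
    and uvw: "tensor_graph t A D u v w" and uvw': "tensor_graph t A D u' v' w'"
  shows "cinner u u' = cinner v v' + cinner w w'"
proof -
  have simple: "cinner u (t x y) = cinner v (t (A x) y) + cinner w (t (D x) y)" for x y
    using uvw
  proof induction
    case (plus u v w x' y')
    then show ?case
      by (simp add: cinner_add_left hilbert_tensorD(5)[OF t] iso[of x' x] algebra_simps)
  qed (simp add: cinner.zero_left)
  show ?thesis
    using uvw'
    by induction (simp_all add: cinner.zero_right cinner_add_right simple)
qed

lemma tensor_graph_add:
  assumes "tensor_graph t A D u v w" "tensor_graph t A D u' v' w'"
  shows "tensor_graph t A D (u + u') (v + v') (w + w')"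
  using assms(2,1)
proof induction
  case (plus u' v' w' x y)
  then show ?case
    using tensor_graph.plus[of t A D "u + u'" "v + v'" "w + w'" x y] by (simp add: add.assoc)
qed simp

lemma tensor_graph_scale:
  assumes t: "hilbert_tensor t" and A: "bounded_clinear A" and D: "bounded_clinear D"
    and "tensor_graph t A D u v w"
  shows "tensor_graph t A D (c *\<^sub>C u) (c *\<^sub>C v) (c *\<^sub>C w)"
  using assms(4)
proof induction
  case zero
  then show ?case by (simp add: tensor_graph.zero)
next
  case (plus u v w x y)
  then show ?case
    using tensor_graph.plus[of t A D "c *\<^sub>C u" "c *\<^sub>C v" "c *\<^sub>C w" "c *\<^sub>C x" y]
    by (simp add: scaleC_add_right hilbert_tensorD[OF t] bounded_clinear_scaleC A D)
qed

text \<open>The defect operator \<open>D = (1 - A\<^sup>* A)\<^bsup>1/2\<^esup>\<close> completes the contraction \<open>A\<close> to an isometry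
  \<open>x \<mapsto> (A x, D x)\<close>.\<close>

lemma contraction_tensor_id_exists:
  fixes t :: "'a::complex_hilbert \<Rightarrow> 'b::complex_hilbert \<Rightarrow> 'k::complex_hilbert"
  assumes t: "hilbert_tensor t" and A: "bounded_clinear A" and contr: "\<And>x. norm (A x) \<le> norm x"
  shows "\<exists>L. bounded_clinear L \<and> (\<forall>x y. L (t x y) = t (A x) y)"
proof -
  obtain A' where A': "bounded_clinear A'" "\<And>x y. cinner (A' x) y = cinner x (A y)"
    using adjoint_exists[OF A] by blast
  have "positive_op (\<lambda>x. x - A' (A x))"
  proof (rule positive_opI)
    fix x
    have "(norm (A x))\<^sup>2 \<le> (norm x)\<^sup>2" using contr by (intro power_mono) auto
    then show "\<exists>r\<ge>0. cinner (x - A' (A x)) x = complex_of_real r"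
      by (intro exI[of _ "(norm x)\<^sup>2 - (norm (A x))\<^sup>2"]) (simp add: cinner.diff_left A' cinner_self)
  qed (intro bounded_clinear_diff bounded_clinear_id bounded_clinear_compose[OF A'(1) A])
  then obtain D where D: "positive_op D" "\<And>x. D (D x) = x - A' (A x)"
    using positive_sqrt_exists by blast
  have iso: "cinner x x' = cinner (A x) (A x') + cinner (D x) (D x')" for x x'
  proof -
    have "cinner (D x) (D x') = cinner (D (D x)) x'"
      by (rule positive_op_selfadjoint[OF D(1), symmetric])
    then show ?thesis by (simp add: D(2) cinner.diff_left A')
  qed
  note graph_scale = tensor_graph_scale[OF t A positive_op_bounded[OF D(1)]]
  define R where "R u v \<longleftrightarrow> (\<exists>w. tensor_graph t A D u v w)" for u v
  have "\<exists>v. R u v" if "u \<in> cspan {t x y |x y. True}" for u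
    using that
  proof (induction rule: cvs.span_induct_alt)
    case base
    then show ?case unfolding R_def using tensor_graph.zero by blast
  next
    case (step c s u)
    then obtain x y v w where "s = t x y" "tensor_graph t A D u v w"
      unfolding R_def by blast
    then have "tensor_graph t A D (u + t (c *\<^sub>C x) y) (v + t (A (c *\<^sub>C x)) y) (w + t (D (c *\<^sub>C x)) y)"
      by (intro tensor_graph.plus)
    then show ?case
      unfolding R_def using \<open>s = t x y\<close> by (auto simp: hilbert_tensorD[OF t] add.commute)
  qed
  then have "closure (cspan {t x y |x y. True}) \<subseteq> closure {u. \<exists>v. R u v}"
    by (intro closure_mono) auto
  then have "closure {u. \<exists>v. R u v} = UNIV"
    using hilbert_tensorD(6)[OF t] by auto
  moreover have "norm v \<le> norm u" if R: "R u v" for u v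
  proof -
    obtain w where "tensor_graph t A D u v w" using R unfolding R_def by blast
    then have "cinner u u = cinner v v + cinner w w"
      using tensor_graph_isometry[OF t iso] by blast
    then have "(norm u)\<^sup>2 = (norm v)\<^sup>2 + (norm w)\<^sup>2"
      unfolding Re_cinner_self[symmetric] by simp
    then show ?thesis by (metis le_add_same_cancel1 norm_ge_zero power2_le_imp_le zero_le_power2)
  qed
  moreover have "R (u + u') (v + v')" if "R u v" "R u' v'" for u v u' v'
    using that tensor_graph_add unfolding R_def by blast
  moreover have "R (c *\<^sub>C u) (c *\<^sub>C v)" if "R u v" for c u v
    using that graph_scale unfolding R_def by blast
  ultimately obtain L where L: "bounded_clinear L" "\<And>u v. R u v \<Longrightarrow> L u = v"
    using dense_contraction_extension[of R] by blast
  have "R (t x y) (t (A x) y)" for x y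
    unfolding R_def using tensor_graph.plus[OF tensor_graph.zero, of t A D x y] by auto
  then show ?thesis using L by blast
qed

lemma tensor_id_exists:
  fixes t :: "'a::complex_hilbert \<Rightarrow> 'b::complex_hilbert \<Rightarrow> 'k::complex_hilbert"
  assumes t: "hilbert_tensor t" and A: "bounded_clinear A"
  shows "\<exists>L. bounded_clinear L \<and> (\<forall>x y. L (t x y) = t (A x) y)"
proof -
  obtain K where K: "K > 0" "\<And>x. norm (A x) \<le> norm x * K"
    using bounded_linear.pos_bounded[OF bounded_clinear_linear[OF A]] by blast
  have "norm (of_real (1/K) *\<^sub>C A x) \<le> norm x" for x
    using K(2)[of x] K(1) by (simp add: norm_scaleC norm_divide field_simps)
  then obtain L where L: "bounded_clinear L" "\<And>x y. L (t x y) = t (of_real (1/K) *\<^sub>C A x) y"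
    using contraction_tensor_id_exists[OF t bounded_clinear_scale[OF A]] by blast
  have "of_real K *\<^sub>C L (t x y) = t (A x) y" for x y
    using K by (simp add: L(2) hilbert_tensorD[OF t] scaleC_scaleC)
  then show ?thesis
    using bounded_clinear_scale[OF L(1)] by blast
qed

text \<open>\<open>A \<otimes> B = (A \<otimes> 1) (1 \<otimes> B)\<close>, where the second factor is an instance of the first one for the flipped
  tensor product.\<close>

lemma op_tensor_exists:
  fixes t :: "'a::complex_hilbert \<Rightarrow> 'b::complex_hilbert \<Rightarrow> 'k::complex_hilbert"
  assumes t: "hilbert_tensor t" and A: "bounded_clinear A" and B: "bounded_clinear B"
  shows "\<exists>C. bounded_clinear C \<and> (\<forall>x y. C (t x y) = t (A x) (B y))"
proof -
  obtain L where L: "bounded_clinear L" "\<And>x y. L (t x y) = t (A x) y"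
    using tensor_id_exists[OF t A] by blast
  obtain L' where L': "bounded_clinear L'" "\<And>x y. L' (t x y) = t x (B y)"
    using tensor_id_exists[OF hilbert_tensor_flip[OF t] B] by blast
  have "bounded_clinear (\<lambda>u. L (L' u))" by (rule bounded_clinear_compose[OF L(1) L'(1)])
  moreover have "L (L' (t x y)) = t (A x) (B y)" for x y by (simp add: L L')
  ultimately show ?thesis by blast
qed

text \<open>By uniqueness of the modulus it suffices that \<open>P = |A| \<otimes> |B|\<close> is positive and that \<open>P\<^sup>2 = M\<^sup>* M\<close>.
  The latter can be tested on simple tensors. Positivity cannot, but \<open>P\<close> is the square of the
  tensor product of the roots of \<open>|A|\<close> and \<open>|B|\<close>, and that operator being self-adjoint can be.\<close>

lemma abs_op_tensor:
  fixes t :: "'a::complex_hilbert \<Rightarrow> 'b::complex_hilbert \<Rightarrow> 'k::complex_hilbert"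
  assumes t: "hilbert_tensor t" and A: "bounded_clinear A" and B: "bounded_clinear B"
    and M: "bounded_clinear M" and MAB: "\<And>x y. M (t x y) = t (A x) (B y)"
  shows "abs_op M (t x y) = t (abs_op A x) (abs_op B y)"
proof -
  obtain S1 where S1: "positive_op S1" "\<And>x. S1 (S1 x) = abs_op A x"
    using positive_sqrt_exists[OF positive_op_abs_op[OF A]] by blast
  obtain S2 where S2: "positive_op S2" "\<And>y. S2 (S2 y) = abs_op B y"
    using positive_sqrt_exists[OF positive_op_abs_op[OF B]] by blast
  note sa = positive_op_selfadjoint[OF S1(1)] positive_op_selfadjoint[OF S2(1)]
  obtain R where R: "bounded_clinear R" "\<And>x y. R (t x y) = t (S1 x) (S2 y)"
    using op_tensor_exists[OF t positive_op_bounded[OF S1(1)] positive_op_bounded[OF S2(1)]] by blast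
  obtain R' where R': "bounded_clinear R'" "\<And>u v. cinner (R' u) v = cinner u (R v)"
    using adjoint_exists[OF R(1)] by blast
  \<comment> \<open>Self-adjointness of \<open>R\<close> follows from its action on simple tensors by comparing with its adjoint.\<close>
  have "R' = R"
  proof (rule tensor_op_eqI[OF t R'(1) R(1)])
    fix x y
    show "R' (t x y) = R (t x y)"
      by (rule tensor_vector_eqI[OF t]) (simp add: R' R hilbert_tensorD[OF t] sa)
  qed
  then have R_sa: "cinner (R u) v = cinner u (R v)" for u v
    using R' by simp
  define P where "P u = R (R u)" for u
  have P: "positive_op P"
    unfolding P_def by (rule positive_op_square[OF R(1) R_sa])
  have P_tensor: "P (t x y) = t (abs_op A x) (abs_op B y)" for x y
    by (simp add: P_def R S1 S2)
  obtain M' where M': "bounded_clinear M'" "\<And>u v. cinner (M' u) v = cinner u (M v)"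
    using adjoint_exists[OF M] by blast
  have "(\<lambda>u. P (P u)) = (\<lambda>u. M' (M u))"
  proof (rule tensor_op_eqI[OF t])
    fix x y
    show "P (P (t x y)) = M' (M (t x y))"
      by (rule tensor_vector_eqI[OF t])
        (simp add: P_tensor M' MAB hilbert_tensorD[OF t] abs_op_square A B)
  qed (rule bounded_clinear_compose[OF positive_op_bounded[OF P] positive_op_bounded[OF P]]
      bounded_clinear_compose[OF M'(1) M])+
  then have "cinner (P (P u)) v = cinner (M u) (M v)" for u v
    using M'(2) by metis
  then have "abs_op M = P" by (rule abs_op_eqI[OF P])
  then show ?thesis by (simp add: P_tensor)
qed

section \<open>Traces and orthonormal systems\<close>

definition orthonormal :: "'a::complex_hilbert set \<Rightarrow> bool" where
  "orthonormal U \<longleftrightarrow> (\<forall>e\<in>U. \<forall>e'\<in>U. cinner e e' = (if e = e' then 1 else 0))"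

lemma is_onb_orthonormal: "is_onb E \<Longrightarrow> F \<subseteq> E \<Longrightarrow> orthonormal F"
  by (auto simp: is_onb_def orthonormal_def cinner_self subset_iff)

text \<open>The term with \<open>c\<close> is smallest for the Fourier coefficients. So this contains the Bessel
  inequality as well as the best approximation property that proves the Parseval identity.\<close>

lemma norm_diff_orthonormal_sum:
  fixes x :: "'a::complex_hilbert"
  assumes F: "finite F" "orthonormal F"
  shows "(norm (x - (\<Sum>e\<in>F. c e *\<^sub>C e)))\<^sup>2
    = (norm x)\<^sup>2 - (\<Sum>e\<in>F. (cmod (cinner x e))\<^sup>2) + (\<Sum>e\<in>F. (cmod (cinner x e - c e))\<^sup>2)"
proof -
  let ?p = "\<Sum>e\<in>F. c e *\<^sub>C e"
  have xp: "cinner z ?p = (\<Sum>e\<in>F. cnj (c e) * cinner z e)" for z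
    by (simp add: cinner.sum_right cinner_scaleC_right)
  have pe: "cinner ?p e = c e" if "e \<in> F" for e
  proof -
    have "cinner ?p e = (\<Sum>e'\<in>F. if e' = e then c e' else 0)"
      unfolding cinner.sum_left
      using F(2) that by (intro sum.cong) (auto simp: cinner_scaleC_left orthonormal_def)
    then show ?thesis using F(1) that by simp
  qed
  have "(norm ?p)\<^sup>2 = Re (\<Sum>e\<in>F. cnj (c e) * c e)"
    unfolding Re_cinner_self[symmetric] xp using pe by (intro arg_cong[of _ _ Re] sum.cong) auto
  then have pp: "(norm ?p)\<^sup>2 = (\<Sum>e\<in>F. (cmod (c e))\<^sup>2)"
    by (simp add: cmod_power2 flip: power2_eq_square)
  have "(cmod (cinner x e - c e))\<^sup>2 - (cmod (cinner x e))\<^sup>2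
      = (cmod (c e))\<^sup>2 - 2 * Re (cnj (c e) * cinner x e)" for e
    unfolding cmod_power2 by (simp add: power2_eq_square algebra_simps)
  then have "(\<Sum>e\<in>F. (cmod (cinner x e - c e))\<^sup>2) - (\<Sum>e\<in>F. (cmod (cinner x e))\<^sup>2)
      = (\<Sum>e\<in>F. (cmod (c e))\<^sup>2) - 2 * Re (cinner x ?p)"
    by (simp add: xp sum_subtractf[symmetric] sum_distrib_left)
  then show ?thesis
    using norm_diff_sq[of x ?p] pp by linarith
qed

lemma Bessel_inequality:
  fixes x :: "'a::complex_hilbert"
  assumes "finite F" "orthonormal F"
  shows "(\<Sum>e\<in>F. (cmod (cinner x e))\<^sup>2) \<le> (norm x)\<^sup>2"
proof -
  have "0 \<le> (norm (x - (\<Sum>e\<in>F. cinner x e *\<^sub>C e)))\<^sup>2" by simp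
  then show ?thesis
    unfolding norm_diff_orthonormal_sum[OF assms] by simp
qed

lemma onb_approx_Parseval:
  fixes x :: "'a::complex_hilbert"
  assumes E: "is_onb E" and "\<epsilon> > 0"
  shows "\<exists>F. finite F \<and> F \<subseteq> E \<and> (norm x)\<^sup>2 \<le> (\<Sum>e\<in>F. (cmod (cinner x e))\<^sup>2) + \<epsilon>"
proof -
  have "x \<in> closure (cspan E)" using E by (simp add: is_onb_def)
  then obtain y where y: "y \<in> cspan E" "dist y x < sqrt \<epsilon>"
    using \<open>\<epsilon> > 0\<close> by (metis closure_approachable real_sqrt_gt_zero)
  obtain F c where F: "finite F" "F \<subseteq> E" and y_eq: "y = (\<Sum>e\<in>F. c e *\<^sub>C e)"
    using y(1) unfolding cvs.span_explicit by blast
  have "(norm x)\<^sup>2 - (\<Sum>e\<in>F. (cmod (cinner x e))\<^sup>2) \<le> (norm (x - y))\<^sup>2"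
    unfolding y_eq norm_diff_orthonormal_sum[OF F(1) is_onb_orthonormal[OF E F(2)]]
    by (simp add: sum_nonneg)
  also have "\<dots> \<le> (sqrt \<epsilon>)\<^sup>2"
    using y(2) by (intro power_mono) (auto simp: dist_norm norm_minus_commute)
  also have "\<dots> = \<epsilon>" using \<open>\<epsilon> > 0\<close> by simp
  finally show ?thesis using F by (intro exI[of _ F]) simp
qed

text \<open>By the Parseval identity for \<open>E\<close> and the Bessel inequality for \<open>U\<close>,
  \<open>\<Sum>\<^sub>u \<parallel>S u\<parallel>\<^sup>2 = \<Sum>\<^sub>u \<Sum>\<^sub>e |\<langle>S u, e\<rangle>|\<^sup>2 = \<Sum>\<^sub>e \<Sum>\<^sub>u |\<langle>u, S e\<rangle>|\<^sup>2 \<le> \<Sum>\<^sub>e \<parallel>S e\<parallel>\<^sup>2\<close>. Finite subsets of \<open>E\<close> that exhaust each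
  of the finitely many \<open>\<parallel>S u\<parallel>\<^sup>2\<close> up to a small error replace the infinite sums.\<close>

lemma hilbert_schmidt_sum_le:
  fixes S :: "'a::complex_hilbert \<Rightarrow> 'a"
  assumes sa: "\<And>x y. cinner (S x) y = cinner x (S y)" and E: "is_onb E"
    and bound: "\<And>F. finite F \<Longrightarrow> F \<subseteq> E \<Longrightarrow> (\<Sum>e\<in>F. (norm (S e))\<^sup>2) \<le> B"
    and U: "finite U" "orthonormal U"
  shows "(\<Sum>u\<in>U. (norm (S u))\<^sup>2) \<le> B"
proof (rule field_le_epsilon)
  fix \<epsilon> :: real assume \<epsilon>: "\<epsilon> > 0"
  \<comment> \<open>The summand 1 keeps \<open>\<delta>\<close> positive for empty \<open>U\<close>.\<close>
  define \<delta> where "\<delta> = \<epsilon> / (real (card U) + 1)"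
  have "\<delta> > 0" using \<epsilon> by (simp add: \<delta>_def)
  have "\<exists>F. finite F \<and> F \<subseteq> E \<and> (norm (S u))\<^sup>2 \<le> (\<Sum>e\<in>F. (cmod (cinner (S u) e))\<^sup>2) + \<delta>" for u
    using onb_approx_Parseval[OF E \<open>\<delta> > 0\<close>] .
  then obtain F where F: "\<And>u. finite (F u)" "\<And>u. F u \<subseteq> E"
    "\<And>u. (norm (S u))\<^sup>2 \<le> (\<Sum>e\<in>F u. (cmod (cinner (S u) e))\<^sup>2) + \<delta>" by metis
  define F' where "F' = (\<Union>u\<in>U. F u)"
  have F': "finite F'" "F' \<subseteq> E" using F U by (auto simp: F'_def)
  have "(\<Sum>u\<in>U. (norm (S u))\<^sup>2) \<le> (\<Sum>u\<in>U. (\<Sum>e\<in>F'. (cmod (cinner (S u) e))\<^sup>2) + \<delta>)"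
  proof (rule sum_mono)
    fix u assume "u \<in> U"
    then have "(\<Sum>e\<in>F u. (cmod (cinner (S u) e))\<^sup>2) \<le> (\<Sum>e\<in>F'. (cmod (cinner (S u) e))\<^sup>2)"
      using F'(1) by (intro sum_mono2) (auto simp: F'_def)
    then show "(norm (S u))\<^sup>2 \<le> (\<Sum>e\<in>F'. (cmod (cinner (S u) e))\<^sup>2) + \<delta>"
      using F(3)[of u] by linarith
  qed
  also have "\<dots> = (\<Sum>e\<in>F'. \<Sum>u\<in>U. (cmod (cinner (S u) e))\<^sup>2) + real (card U) * \<delta>"
    by (simp add: sum.distrib sum.swap[of _ U])
  also have "(\<Sum>e\<in>F'. \<Sum>u\<in>U. (cmod (cinner (S u) e))\<^sup>2) \<le> (\<Sum>e\<in>F'. (norm (S e))\<^sup>2)"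
  proof (rule sum_mono)
    fix e
    have "cmod (cinner (S u) e) = cmod (cinner (S e) u)" for u
      by (metis sa cinner_commute complex_mod_cnj)
    then show "(\<Sum>u\<in>U. (cmod (cinner (S u) e))\<^sup>2) \<le> (norm (S e))\<^sup>2"
      using Bessel_inequality[OF U] by simp
  qed
  also have "\<dots> \<le> B" by (rule bound[OF F'])
  also have "real (card U) * \<delta> \<le> \<epsilon>"
    using \<epsilon> by (simp add: \<delta>_def field_simps)
  finally show "(\<Sum>u\<in>U. (norm (S u))\<^sup>2) \<le> B + \<epsilon>" by simp
qed

lemma trace_class_bounded: "trace_class A \<Longrightarrow> bounded_clinear A"
  by (simp add: trace_class_def)

text \<open>The trace norm of \<open>A\<close>, computed in the basis that witnesses \<open>trace_class A\<close>, serves as the bound: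
  \<open>\<langle>|A| u, u\<rangle> = \<parallel>S u\<parallel>\<^sup>2\<close> for the root \<open>S\<close> of \<open>|A|\<close>.\<close>

lemma trace_class_orthonormal_bound:
  fixes A :: "'a::complex_hilbert \<Rightarrow> 'a"
  assumes "trace_class A"
  shows "\<exists>B. \<forall>U. finite U \<longrightarrow> orthonormal U \<longrightarrow> (\<Sum>u\<in>U. Re (cinner (abs_op A u) u)) \<le> B"
proof -
  have pos: "positive_op (abs_op A)"
    using assms by (intro positive_op_abs_op trace_class_bounded)
  obtain S where S: "positive_op S" "\<And>x. S (S x) = abs_op A x"
    using positive_sqrt_exists[OF pos] by blast
  have sq: "Re (cinner (abs_op A x) x) = (norm (S x))\<^sup>2" for x
    by (simp add: S(2)[symmetric] positive_op_selfadjoint[OF S(1), of "S x"] Re_cinner_self)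
  obtain E where E: "is_onb E" "(\<lambda>e. cinner (abs_op A e) e) summable_on E"
    using assms unfolding trace_class_def by blast
  have summ: "(\<lambda>e. (norm (S e))\<^sup>2) summable_on E"
    using summable_on_Re[OF E(2)] by (simp add: sq)
  have "(\<Sum>e\<in>F. (norm (S e))\<^sup>2) \<le> (\<Sum>\<^sub>\<infinity>e\<in>E. (norm (S e))\<^sup>2)" if "finite F" "F \<subseteq> E" for F
    using finite_sum_le_infsum[OF summ that] by simp
  then have "(\<Sum>u\<in>U. (norm (S u))\<^sup>2) \<le> (\<Sum>\<^sub>\<infinity>e\<in>E. (norm (S e))\<^sup>2)"
    if "finite U" "orthonormal U" for U
    using hilbert_schmidt_sum_le[OF positive_op_selfadjoint[OF S(1)] E(1) _ that] by blast
  then show ?thesis unfolding sq by blast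
qed

lemma trace_classI_onb_bound:
  fixes A :: "'a::complex_hilbert \<Rightarrow> 'a"
  assumes A: "bounded_clinear A" and E: "is_onb E"
    and bound: "\<And>F. finite F \<Longrightarrow> F \<subseteq> E \<Longrightarrow> (\<Sum>e\<in>F. Re (cinner (abs_op A e) e)) \<le> B"
  shows "trace_class A"
proof -
  have pos: "positive_op (abs_op A)" by (rule positive_op_abs_op[OF A])
  have "(\<lambda>e. Re (cinner (abs_op A e) e)) summable_on E"
    by (intro nonneg_bdd_above_summable_on bdd_aboveI[of _ B])
      (auto intro: bound simp: positive_op_nonneg[OF pos])
  then have "(\<lambda>e. complex_of_real (Re (cinner (abs_op A e) e))) summable_on E"
    by (rule summable_on_of_real)
  then have "(\<lambda>e. cinner (abs_op A e) e) summable_on E"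
    by (simp flip: positive_op_real[OF pos])
  then show ?thesis
    unfolding trace_class_def using A E by blast
qed

text \<open>Restrict the diagonal of \<open>|M| = |A| \<otimes> |B|\<close> to the orthonormal vectors \<open>e \<otimes> y\<close> for a unit vector
  \<open>y\<close> with \<open>B y \<noteq> 0\<close>; up to the factor \<open>\<langle>|B| y, y\<rangle>\<close>, this is the diagonal of \<open>|A|\<close>.\<close>

lemma trace_class_tensor_factor:
  fixes t :: "'a::complex_hilbert \<Rightarrow> 'b::complex_hilbert \<Rightarrow> 'k::complex_hilbert"
  assumes t: "hilbert_tensor t" and A: "bounded_clinear A" and B: "bounded_clinear B"
    and M: "trace_class M" and MAB: "\<And>x y. M (t x y) = t (A x) (B y)"
    and nz: "B \<noteq> (\<lambda>_. 0)" and E: "is_onb (E :: 'a set)"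
  shows "trace_class A"
proof -
  have posA: "positive_op (abs_op A)" and posB: "positive_op (abs_op B)"
    by (rule positive_op_abs_op A B)+
  obtain y0 where y0: "B y0 \<noteq> 0" using nz by auto
  then have "y0 \<noteq> 0"
    using linear_0[OF bounded_linear.linear[OF bounded_clinear_linear[OF B]]] by auto
  define y where "y = of_real (1 / norm y0) *\<^sub>C y0"
  have y1: "norm y = 1" using \<open>y0 \<noteq> 0\<close> by (simp add: y_def norm_scaleC norm_divide)
  have By: "B y \<noteq> 0"
    using y0 \<open>y0 \<noteq> 0\<close> by (simp add: y_def bounded_clinear_scaleC[OF B])
  define b where "b = Re (cinner (abs_op B y) y)"
  have "b \<noteq> 0"
  proof
    assume "b = 0"
    then have "abs_op B y = 0" using positive_op_eq_zero[OF posB] by (simp add: b_def)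
    then have "cinner (B y) (B y) = 0"
      by (metis abs_op_square[OF B] positive_op_selfadjoint[OF posB] cinner.zero_left)
    then show False using By by simp
  qed
  then have b: "b > 0" using positive_op_nonneg[OF posB, of y] by (simp add: b_def)
  have entry: "Re (cinner (abs_op M (t e y)) (t e y)) = Re (cinner (abs_op A e) e) * b" for e
  proof -
    have "cinner (abs_op M (t e y)) (t e y) = cinner (abs_op A e) e * cinner (abs_op B y) y"
      by (simp add: abs_op_tensor[OF t A B trace_class_bounded[OF M] MAB] hilbert_tensorD[OF t])
    also have "\<dots> = of_real (Re (cinner (abs_op A e) e)) * of_real b"
      unfolding b_def by (simp only: positive_op_real[OF posA, symmetric] positive_op_real[OF posB, symmetric])
    finally show ?thesis by simp
  qed
  obtain C where C: "\<And>U. finite U \<Longrightarrow> orthonormal U \<Longrightarrow> (\<Sum>u\<in>U. Re (cinner (abs_op M u) u)) \<le> C"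
    using trace_class_orthonormal_bound[OF M] by blast
  show ?thesis
  proof (rule trace_classI_onb_bound[OF A E])
    fix F assume F: "finite F" "F \<subseteq> E"
    have ortho: "cinner (t e y) (t e' y) = (if e = e' then 1 else 0)" if "e \<in> F" "e' \<in> F" for e e'
      using is_onb_orthonormal[OF E F(2)] that
      by (simp add: hilbert_tensorD[OF t] cinner_self y1 orthonormal_def)
    have inj: "inj_on (\<lambda>e. t e y) F"
    proof (rule inj_onI)
      fix e e' assume "e \<in> F" "e' \<in> F" "t e y = t e' y"
      then show "e = e'" using ortho[of e e'] ortho[of e' e'] by (simp split: if_splits)
    qed
    have "orthonormal ((\<lambda>e. t e y) ` F)"
      unfolding orthonormal_def using ortho by (auto dest: inj_onD[OF inj])
    then have "(\<Sum>u\<in>(\<lambda>e. t e y) ` F. Re (cinner (abs_op M u) u)) \<le> C"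
      using F by (intro C) auto
    then have "(\<Sum>e\<in>F. Re (cinner (abs_op A e) e)) * b \<le> C"
      by (simp add: sum.reindex[OF inj] entry sum_distrib_right)
    then show "(\<Sum>e\<in>F. Re (cinner (abs_op A e) e)) \<le> C / b"
      using b by (simp add: field_simps)
  qed
qed

section \<open>Integrals of product functions\<close>

text \<open>Almost every section \<open>y \<mapsto> h x * k y\<close> is integrable, and some of these sections have \<open>h x \<noteq> 0\<close>.\<close>

lemma integrable_product_factor:
  fixes h :: "'x \<Rightarrow> complex" and k :: "'y \<Rightarrow> complex"
  assumes "sigma_finite_measure X" "sigma_finite_measure Y"
    and int: "integrable (X \<Otimes>\<^sub>M Y) (\<lambda>(x, y). h x * k y)"
    and nz: "\<not> (AE x in X. h x = 0)"
  shows "integrable Y k"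
proof -
  interpret pair_sigma_finite X Y using assms(1,2) by (rule pair_sigma_finite.intro)
  have "AE x in X. integrable Y (\<lambda>y. h x * k y)"
    using AE_integrable_fst'[OF int] by simp
  then have *: "AE x in X. h x \<noteq> 0 \<longrightarrow> integrable Y k"
  proof (rule eventually_mono, intro impI)
    fix x assume "integrable Y (\<lambda>y. h x * k y)" "h x \<noteq> 0"
    then show "integrable Y k"
      using integrable_mult_right[of "1 / h x" Y "\<lambda>y. h x * k y"] by simp
  qed
  show ?thesis
  proof (rule ccontr)
    assume "\<not> integrable Y k"
    then have "AE x in X. h x = 0"
      using * by (auto elim!: eventually_mono)
    then show False using nz by blast
  qed
qed

lemma integral_product:
  fixes h :: "'x \<Rightarrow> complex" and k :: "'y \<Rightarrow> complex"
  assumes "sigma_finite_measure X" "sigma_finite_measure Y"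
    and int: "integrable (X \<Otimes>\<^sub>M Y) (\<lambda>(x, y). h x * k y)"
  shows "(\<integral>z. (case z of (x, y) \<Rightarrow> h x * k y) \<partial>(X \<Otimes>\<^sub>M Y)) = (\<integral>x. h x \<partial>X) * (\<integral>y. k y \<partial>Y)"
proof -
  interpret pair_sigma_finite X Y using assms(1,2) by (rule pair_sigma_finite.intro)
  show ?thesis using integral_fst'[OF int] by simp
qed

lemma AE_zero_integrable:
  fixes k :: "'z \<Rightarrow> complex"
  assumes "k \<in> borel_measurable N" "AE x in N. k x = 0"
  shows "integrable N k \<and> (\<integral>x. k x \<partial>N) = 0"
proof
  have "integrable N k \<longleftrightarrow> integrable N (\<lambda>_. 0 :: complex)"
    using assms by (intro integrable_cong_AE) auto
  then show "integrable N k" by simp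
qed (rule integral_eq_zero_AE[OF assms(2)])

lemma not_AE_zero: "(\<integral>x. k x \<partial>N) \<noteq> 0 \<Longrightarrow> \<not> (AE x in N. k x = 0)"
  for k :: "'z \<Rightarrow> complex"
  using integral_eq_zero_AE by blast

section \<open>Multipliers\<close>

definition multiplier_integrand ::
    "('x \<Rightarrow> complex) \<Rightarrow> ('x \<Rightarrow> 'a::complex_hilbert) \<Rightarrow> ('x \<Rightarrow> 'a) \<Rightarrow> 'a \<Rightarrow> 'a \<Rightarrow> 'x \<Rightarrow> complex"
  where "multiplier_integrand m F G f g x = m x * cinner f (F x) * cinner (G x) g"

lemma has_multiplier_integrand:
  "has_multiplier X m F G A \<longleftrightarrow> (\<forall>f g. integrable X (multiplier_integrand m F G f g) \<and>
     cinner (A f) g = (\<integral>x. multiplier_integrand m F G f g x \<partial>X))"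
  unfolding has_multiplier_def multiplier_integrand_def ..

lemma multiplier_eqI:
  assumes A: "has_multiplier X m F G A"
  shows "multiplier X m F G = A"
proof -
  have "B = A" if B: "has_multiplier X m F G B" for B
  proof
    fix f
    show "B f = A f"
      by (rule cinner_eqI) (use A B in \<open>simp add: has_multiplier_def\<close>)
  qed
  then have "(THE A. has_multiplier X m F G A) = A"
    using A by (intro the_equality)
  then show ?thesis unfolding multiplier_def using A by auto
qed

lemma has_multiplier_scale:
  assumes "has_multiplier X m F G A"
  shows "has_multiplier X (\<lambda>x. c * m x) F G (\<lambda>f. c *\<^sub>C A f)"
  using assms unfolding has_multiplier_def by (simp add: cinner_scaleC_left mult.assoc)

lemma has_multiplier_swap:
  assumes "sigma_finite_measure X" "sigma_finite_measure Y"
    and M: "has_multiplier (X \<Otimes>\<^sub>M Y) (\<lambda>(x, y). m1 x * m2 y) (\<lambda>(x, y). t (F1 x) (F2 y))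
      (\<lambda>(x, y). t (G1 x) (G2 y)) M"
  shows "has_multiplier (Y \<Otimes>\<^sub>M X) (\<lambda>(y, x). m2 y * m1 x) (\<lambda>(y, x). t (F1 x) (F2 y))
      (\<lambda>(y, x). t (G1 x) (G2 y)) M"
  unfolding has_multiplier_def
proof (intro allI)
  interpret pair_sigma_finite X Y using assms(1,2) by (rule pair_sigma_finite.intro)
  fix f g
  let ?h = "\<lambda>(x, y). m1 x * m2 y * cinner f (t (F1 x) (F2 y)) * cinner (t (G1 x) (G2 y)) g"
  have h: "integrable (X \<Otimes>\<^sub>M Y) ?h" "cinner (M f) g = (\<integral>z. ?h z \<partial>(X \<Otimes>\<^sub>M Y))"
    using M unfolding has_multiplier_def by (auto simp: case_prod_unfold)
  have swap: "(\<lambda>z. (case z of (y, x) \<Rightarrow> m2 y * m1 x) * cinner f (case z of (y, x) \<Rightarrow> t (F1 x) (F2 y)) *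
      cinner (case z of (y, x) \<Rightarrow> t (G1 x) (G2 y)) g) = (\<lambda>(y, x). ?h (x, y))"
    by (auto simp: mult.commute)
  show "integrable (Y \<Otimes>\<^sub>M X) (\<lambda>z. (case z of (y, x) \<Rightarrow> m2 y * m1 x) *
        cinner f (case z of (y, x) \<Rightarrow> t (F1 x) (F2 y)) * cinner (case z of (y, x) \<Rightarrow> t (G1 x) (G2 y)) g) \<and>
      cinner (M f) g = (\<integral>z. (case z of (y, x) \<Rightarrow> m2 y * m1 x) *
        cinner f (case z of (y, x) \<Rightarrow> t (F1 x) (F2 y)) * cinner (case z of (y, x) \<Rightarrow> t (G1 x) (G2 y)) g
        \<partial>(Y \<Otimes>\<^sub>M X))"
    unfolding swap
    using integrable_product_swap[OF h(1)] integral_product_swap[of ?h] h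
    by (simp add: borel_measurable_integrable)
qed

lemma measurable_multiplier_integrand:
  assumes "m \<in> borel_measurable X" "weakly_measurable X F" "weakly_measurable X G"
  shows "multiplier_integrand m F G f g \<in> borel_measurable X"
proof -
  have cnj: "cnj \<in> borel_measurable borel"
    by (intro borel_measurable_continuous_onI continuous_intros)
  have "(\<lambda>x. cinner f (F x)) \<in> borel_measurable X" "(\<lambda>x. cnj (cinner g (G x))) \<in> borel_measurable X"
    using assms(2,3) measurable_compose[OF _ cnj] unfolding weakly_measurable_def by blast+
  then have "(\<lambda>x. m x * cinner f (F x) * cnj (cinner g (G x))) \<in> borel_measurable X"
    using assms(1) by measurable
  moreover have "cnj (cinner g (G x)) = cinner (G x) g" for x
    by (rule cinner_commute[symmetric])
  ultimately show ?thesis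
    unfolding multiplier_integrand_def[abs_def] by simp
qed

lemma op_trace_zero: "op_trace (\<lambda>_. 0) = 0"
  by (simp add: op_trace_def cinner.zero_left)

section \<open>Multipliers with product data\<close>

text \<open>The facts about the second factor are the facts about the first one for the flipped data, by the
  lemma \<open>flip\<close> below.\<close>

locale tensor_multiplier =
  fixes t :: "'a::complex_hilbert \<Rightarrow> 'b::complex_hilbert \<Rightarrow> 'k::complex_hilbert"
    and X :: "'x measure" and Y :: "'y measure"
    and m1 :: "'x \<Rightarrow> complex" and m2 :: "'y \<Rightarrow> complex"
    and F1 G1 :: "'x \<Rightarrow> 'a" and F2 G2 :: "'y \<Rightarrow> 'b" and M :: "'k \<Rightarrow> 'k"
  assumes t: "hilbert_tensor t"
    and sX: "sigma_finite_measure X" and sY: "sigma_finite_measure Y"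
    and M: "has_multiplier (X \<Otimes>\<^sub>M Y) (\<lambda>(x, y). m1 x * m2 y) (\<lambda>(x, y). t (F1 x) (F2 y))
      (\<lambda>(x, y). t (G1 x) (G2 y)) M"
    and M_bounded: "bounded_clinear M"
    and measurable1: "\<And>f g. multiplier_integrand m1 F1 G1 f g \<in> borel_measurable X"
    and measurable2: "\<And>f g. multiplier_integrand m2 F2 G2 f g \<in> borel_measurable Y"
begin

abbreviation "h1 \<equiv> multiplier_integrand m1 F1 G1"
abbreviation "h2 \<equiv> multiplier_integrand m2 F2 G2"

lemma flip: "tensor_multiplier (\<lambda>y x. t x y) Y X m2 m1 F2 G2 F1 G1 M"
  by (rule tensor_multiplier.intro[OF hilbert_tensor_flip[OF t] sY sX has_multiplier_swap[OF sX sY M]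
        M_bounded measurable2 measurable1])

lemma integrable_entry: "integrable (X \<Otimes>\<^sub>M Y) (\<lambda>(x, y). h1 f g x * h2 f' g' y)"
  and entry_product:
    "cinner (M (t f f')) (t g g') = (\<integral>x. h1 f g x \<partial>X) * (\<integral>y. h2 f' g' y \<partial>Y)"
proof -
  have eq: "multiplier_integrand (\<lambda>(x, y). m1 x * m2 y) (\<lambda>(x, y). t (F1 x) (F2 y))
      (\<lambda>(x, y). t (G1 x) (G2 y)) (t f f') (t g g') = (\<lambda>(x, y). h1 f g x * h2 f' g' y)"
    by (auto simp: multiplier_integrand_def hilbert_tensorD[OF t] mult_ac)
  show int: "integrable (X \<Otimes>\<^sub>M Y) (\<lambda>(x, y). h1 f g x * h2 f' g' y)"
    using M unfolding has_multiplier_integrand eq[symmetric] by blast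
  have "cinner (M (t f f')) (t g g')
      = (\<integral>z. (case z of (x, y) \<Rightarrow> h1 f g x * h2 f' g' y) \<partial>(X \<Otimes>\<^sub>M Y))"
    using M unfolding has_multiplier_integrand eq[symmetric] by blast
  then show "cinner (M (t f f')) (t g g') = (\<integral>x. h1 f g x \<partial>X) * (\<integral>y. h2 f' g' y \<partial>Y)"
    using integral_product[OF sX sY int] by simp
qed

lemma integrable_snd:
  assumes "\<not> (AE x in X. h1 f g x = 0)"
  shows "integrable Y (h2 f' g')"
  by (rule integrable_product_factor[OF sX sY integrable_entry assms])

lemma integrable_fst:
  assumes "\<not> (AE y in Y. h2 f g y = 0)"
  shows "integrable X (h1 f' g')"
  by (rule tensor_multiplier.integrable_snd[OF flip assms])

text \<open>Suppose that neither form is given by convergent integrals that all vanish. Then there is an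
  integrand on each side that is not almost everywhere zero; each of them
  forces the other one to be integrable. So both have a nonzero integral, although the product of
  the two integrals is an entry of \<open>M = 0\<close>.\<close>

lemma zero_has_zero_factor:
  assumes "M = (\<lambda>_. 0)"
  shows "has_multiplier X m1 F1 G1 (\<lambda>_. 0) \<or> has_multiplier Y m2 F2 G2 (\<lambda>_. 0)"
proof (rule ccontr)
  assume "\<not> ?thesis"
  then obtain f g f' g'
    where fg: "\<not> (integrable X (h1 f g) \<and> (\<integral>x. h1 f g x \<partial>X) = 0)"
      and fg': "\<not> (integrable Y (h2 f' g') \<and> (\<integral>y. h2 f' g' y \<partial>Y) = 0)"
    unfolding has_multiplier_integrand by (auto simp: cinner.zero_left)
  have nz: "\<not> (AE x in X. h1 f g x = 0)" "\<not> (AE y in Y. h2 f' g' y = 0)"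
    using fg AE_zero_integrable[OF measurable1, of f g] fg' AE_zero_integrable[OF measurable2, of f' g']
    by blast+
  have "(\<integral>x. h1 f g x \<partial>X) * (\<integral>y. h2 f' g' y \<partial>Y) = 0"
    unfolding entry_product[symmetric] assms by (simp add: cinner.zero_left)
  then show False
    using fg fg' integrable_snd[OF nz(1), of f' g'] integrable_fst[OF nz(2), of f g] by auto
qed

lemma nonzero_entry:
  assumes "M \<noteq> (\<lambda>_. 0)"
  shows "\<exists>f f' g g'. cinner (M (t f f')) (t g g') \<noteq> 0"
proof (rule ccontr)
  assume "\<not> ?thesis"
  then have entries: "cinner (M (t f f')) (t g g') = 0" for f f' g g' by blast
  have "M = (\<lambda>_. 0)"
  proof (rule tensor_op_eqI[OF t M_bounded])
    show "M (t x y) = 0" for x y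
      by (rule tensor_vector_eqI[OF t]) (simp add: entries cinner.zero_left)
  qed (rule bounded_clinear_zero)
  then show False using assms by blast
qed

text \<open>Divide the entries of \<open>M\<close> by a fixed nonzero integral over the second space: the first form is
  then visibly bounded.\<close>

lemma fst_factor_exists:
  assumes "M \<noteq> (\<lambda>_. 0)"
  shows "\<exists>A. bounded_clinear A \<and> has_multiplier X m1 F1 G1 A"
proof -
  obtain f0 f' g0 g' where "cinner (M (t f0 f')) (t g0 g') \<noteq> 0"
    using nonzero_entry[OF assms] by blast
  then have nz: "(\<integral>y. h2 f' g' y \<partial>Y) \<noteq> 0"
    by (simp add: entry_product)
  define c where "c = (\<integral>y. h2 f' g' y \<partial>Y)"
  define q where "q f g = cinner (M (t f f')) (t g g') / c" for f g
  have q: "q f g = (\<integral>x. h1 f g x \<partial>X)" for f g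
    using nz by (simp add: q_def c_def entry_product)
  obtain K where K: "\<And>u. norm (M u) \<le> norm u * K"
    using bounded_linear.bounded[OF bounded_clinear_linear[OF M_bounded]] by blast
  have "\<exists>A. bounded_clinear A \<and> (\<forall>f g. cinner (A f) g = q f g)"
  proof (rule bounded_form_operator)
    fix f g
    have "cmod (cinner (M (t f f')) (t g g')) \<le> norm (M (t f f')) * norm (t g g')"
      by (rule Cauchy_Schwarz)
    also have "\<dots> \<le> norm (t f f') * K * norm (t g g')"
      by (intro mult_right_mono K) simp
    also have "\<dots> = norm f' * K * norm g' * norm f * norm g"
      by (simp add: norm_tensor[OF t])
    finally show "cmod (q f g) \<le> norm f' * K * norm g' / cmod c * norm f * norm g"
      by (simp add: q_def norm_divide divide_right_mono)
  qed (simp_all add: q_def hilbert_tensorD[OF t] cinner_add_left cinner_add_right cinner_scaleC_left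
      cinner_scaleC_right bounded_clinear_add[OF M_bounded] bounded_clinear_scaleC[OF M_bounded]
      add_divide_distrib)
  then obtain A where A: "bounded_clinear A" "\<And>f g. cinner (A f) g = q f g" by blast
  have "has_multiplier X m1 F1 G1 A"
    unfolding has_multiplier_integrand
    using A(2) integrable_fst[OF not_AE_zero[OF nz]] by (simp add: q)
  then show ?thesis using A(1) by blast
qed

abbreviation "M1 \<equiv> multiplier X m1 F1 G1"
abbreviation "M2 \<equiv> multiplier Y m2 F2 G2"

lemma nonzero_fst_factor:
  assumes "M \<noteq> (\<lambda>_. 0)"
  shows "bounded_clinear M1" "has_multiplier X m1 F1 G1 M1"
  using fst_factor_exists[OF assms] multiplier_eqI by blast+

lemma nonzero_snd_factor:
  assumes "M \<noteq> (\<lambda>_. 0)"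
  shows "bounded_clinear M2" "has_multiplier Y m2 F2 G2 M2"
  by (rule tensor_multiplier.nonzero_fst_factor[OF flip assms])+

lemma nonzero_tensor:
  assumes "M \<noteq> (\<lambda>_. 0)"
  shows "M (t x y) = t (M1 x) (M2 y)"
proof (rule tensor_vector_eqI[OF t])
  show "cinner (M (t x y)) (t x' y') = cinner (t (M1 x) (M2 y)) (t x' y')" for x' y'
    using nonzero_fst_factor(2)[OF assms] nonzero_snd_factor(2)[OF assms]
    by (simp add: entry_product hilbert_tensorD[OF t] has_multiplier_integrand)
qed

lemma nonzero_factors_nonzero:
  assumes "M \<noteq> (\<lambda>_. 0)"
  shows "M1 \<noteq> (\<lambda>_. 0)" "M2 \<noteq> (\<lambda>_. 0)"
  using nonzero_entry[OF assms]
  by (auto simp: nonzero_tensor[OF assms] hilbert_tensorD[OF t] cinner.zero_left)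

text \<open>This also holds if a factor integral diverges and the factor is the zero operator by
  convention, since then \<open>M = 0\<close>.\<close>

lemma eq_op_tensor: "M = op_tensor t M1 M2"
proof (cases "M = (\<lambda>_. 0)")
  case False
  show ?thesis
    by (rule op_tensor_eqI[OF t M_bounded, symmetric]) (rule nonzero_tensor[OF False])
next
  case True
  have "M1 = (\<lambda>_. 0) \<or> M2 = (\<lambda>_. 0)"
    using zero_has_zero_factor[OF True] by (auto dest: multiplier_eqI)
  then have "t (M1 x) (M2 y) = 0" for x y
    using hilbert_tensorD(3)[OF t, of 0 0] hilbert_tensorD(4)[OF t, of _ 0 0] by auto
  then have "op_tensor t M1 M2 = (\<lambda>_. 0)"
    by (intro op_tensor_eqI[OF t]) (simp_all add: bounded_clinear_zero)
  then show ?thesis using True by simp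
qed

lemma nonzero_fst_trace_class:
  assumes "M \<noteq> (\<lambda>_. 0)" "trace_class M" "is_onb (E :: 'a set)"
  shows "trace_class M1"
proof (rule trace_class_tensor_factor[OF t _ _ assms(2) _ _ assms(3)])
  show "bounded_clinear M1" "bounded_clinear M2" "M2 \<noteq> (\<lambda>_. 0)"
    using assms(1) by (rule nonzero_fst_factor nonzero_snd_factor nonzero_factors_nonzero)+
  show "M (t x y) = t (M1 x) (M2 y)" for x y
    by (rule nonzero_tensor[OF assms(1)])
qed

lemma nonzero_snd_trace_class:
  assumes "M \<noteq> (\<lambda>_. 0)" "trace_class M" "is_onb (E :: 'b set)"
  shows "trace_class M2"
  by (rule tensor_multiplier.nonzero_fst_trace_class[OF flip assms])

lemma partial_trace_fst:
  assumes T: "is_partial_trace_fst t T" and M_tc: "trace_class M"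
    and factors: "M \<noteq> (\<lambda>_. 0) \<Longrightarrow> trace_class M1 \<and> trace_class M2"
  shows "T M = (\<lambda>f. op_trace M2 *\<^sub>C M1 f)"
    and "has_multiplier X (\<lambda>x. op_trace M2 * m1 x) F1 G1 (T M)"
proof -
  have "T M = (\<lambda>f. op_trace M2 *\<^sub>C M1 f) \<and>
    has_multiplier X (\<lambda>x. op_trace M2 * m1 x) F1 G1 (\<lambda>f. op_trace M2 *\<^sub>C M1 f)"
  proof (cases "M = (\<lambda>_. 0)")
    case False
    have "T (op_tensor t M1 M2) = (\<lambda>f. op_trace M2 *\<^sub>C M1 f)"
      using T factors[OF False] unfolding is_partial_trace_fst_def by blast
    then show ?thesis
      using has_multiplier_scale[OF nonzero_fst_factor(2)[OF False]] eq_op_tensor by simp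
  next
    case True
    have "T (\<lambda>f. 0 *\<^sub>C M f) = (\<lambda>f. 0 *\<^sub>C T M f)"
      using T M_tc unfolding is_partial_trace_fst_def by blast
    then have TM: "T M = (\<lambda>_. 0)" by (simp add: True)
    from zero_has_zero_factor[OF True] show ?thesis
    proof
      assume 0: "has_multiplier X m1 F1 G1 (\<lambda>_. 0)"
      then show ?thesis
        using has_multiplier_scale[OF 0, of "op_trace M2"] by (simp add: TM multiplier_eqI)
    next
      assume "has_multiplier Y m2 F2 G2 (\<lambda>_. 0)"
      then have "op_trace M2 = 0" by (simp add: multiplier_eqI op_trace_zero)
      then show ?thesis by (simp add: TM has_multiplier_def cinner.zero_left)
    qed
  qed
  then show "T M = (\<lambda>f. op_trace M2 *\<^sub>C M1 f)"
    "has_multiplier X (\<lambda>x. op_trace M2 * m1 x) F1 G1 (T M)"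
    by simp_all
qed

lemma partial_trace_snd:
  assumes "is_partial_trace_snd t T" and "trace_class M"
    and "M \<noteq> (\<lambda>_. 0) \<Longrightarrow> trace_class M1 \<and> trace_class M2"
  shows "T M = (\<lambda>g. op_trace M1 *\<^sub>C M2 g)"
    and "has_multiplier Y (\<lambda>y. op_trace M1 * m2 y) F2 G2 (T M)"
  using tensor_multiplier.partial_trace_fst[OF flip, of T] assms
  unfolding is_partial_trace_snd_def by blast+

end


theorem corollary5p7:
  fixes t :: "'a::complex_hilbert \<Rightarrow> 'b::complex_hilbert \<Rightarrow> 'k::complex_hilbert"
    and X1 :: "'x measure" and X2 :: "'y measure"
    and m1 :: "'x \<Rightarrow> complex" and m2 :: "'y \<Rightarrow> complex" and m :: "'x \<times> 'y \<Rightarrow> complex"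
    and F1 G1 :: "'x \<Rightarrow> 'a" and F2 G2 :: "'y \<Rightarrow> 'b" and F G :: "'x \<times> 'y \<Rightarrow> 'k"
    and M :: "'k \<Rightarrow> 'k" and M1 :: "'a \<Rightarrow> 'a" and M2 :: "'b \<Rightarrow> 'b"
    and T1 :: "('k \<Rightarrow> 'k) \<Rightarrow> 'a \<Rightarrow> 'a" and T2 :: "('k \<Rightarrow> 'k) \<Rightarrow> 'b \<Rightarrow> 'b"
  assumes "separable_space (euclidean :: 'a topology)"
    and "separable_space (euclidean :: 'b topology)"
    and "hilbert_tensor t"
    and "sigma_finite_measure X1" and "sigma_finite_measure X2"
    and "m1 \<in> borel_measurable X1" and "m2 \<in> borel_measurable X2"
    and "bessel_mapping X1 F1" and "bessel_mapping X1 G1"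
    and "bessel_mapping X2 F2" and "bessel_mapping X2 G2"
    and "m = (\<lambda>(x1, x2). m1 x1 * m2 x2)"
    and "F = (\<lambda>(x1, x2). t (F1 x1) (F2 x2))"
    and "G = (\<lambda>(x1, x2). t (G1 x1) (G2 x2))"
    and "M1 = multiplier X1 m1 F1 G1" and "M2 = multiplier X2 m2 F2 G2"
    and "has_multiplier (X1 \<Otimes>\<^sub>M X2) m F G M" and "trace_class M"
    and "is_partial_trace_fst t T1" and "is_partial_trace_snd t T2"
  shows "M = op_tensor t M1 M2 \<and>
    (M \<noteq> (\<lambda>_. 0) \<longrightarrow>
      bessel_multiplier X1 m1 F1 G1 M1 \<and> trace_class M1 \<and>
      bessel_multiplier X2 m2 F2 G2 M2 \<and> trace_class M2) \<and>
    T1 (op_tensor t M1 M2) = (\<lambda>f. op_trace M2 *\<^sub>C M1 f) \<and>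
    trace_class (T1 M) \<and>
    bessel_multiplier X1 (\<lambda>x. op_trace M2 * m1 x) F1 G1 (T1 M) \<and>
    T2 (op_tensor t M1 M2) = (\<lambda>g. op_trace M1 *\<^sub>C M2 g) \<and>
    trace_class (T2 M) \<and>
    bessel_multiplier X2 (\<lambda>y. op_trace M1 * m2 y) F2 G2 (T2 M) \<and>
    (continuous_frame X1 F1 \<and> continuous_frame X1 G1 \<and>
     continuous_frame X2 F2 \<and> continuous_frame X2 G2 \<longrightarrow>
      frame_multiplier X1 (\<lambda>x. op_trace M2 * m1 x) F1 G1 (T1 M) \<and>
      frame_multiplier X2 (\<lambda>y. op_trace M1 * m2 y) F2 G2 (T2 M))"
proof -
  note t = assms(3) and sf = assms(4,5) and meas = assms(6,7)
    and bessel = assms(8-11) and M_tc = assms(18) and T1 = assms(19) and T2 = assms(20)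
  note m_eq = assms(12-14) and M1_eq = assms(15) and M2_eq = assms(16)
  have weak: "weakly_measurable X1 F1" "weakly_measurable X1 G1"
    "weakly_measurable X2 F2" "weakly_measurable X2 G2"
    using bessel by (simp_all add: bessel_mapping_def)
  note M_mult = assms(17)[unfolded m_eq]
  interpret tensor_multiplier t X1 X2 m1 m2 F1 G1 F2 G2 M
    by (rule tensor_multiplier.intro[OF t sf M_mult trace_class_bounded[OF M_tc]])
      (rule measurable_multiplier_integrand meas weak)+
  have T1_tc: "trace_class (T1 M)" and T2_tc: "trace_class (T2 M)"
    using M_tc T1[unfolded is_partial_trace_fst_def, THEN conjunct1]
      T2[unfolded is_partial_trace_snd_def is_partial_trace_fst_def, THEN conjunct1] by blast+
  \<comment> \<open>Being trace class includes the existence of an orthonormal basis, so the partial traces of \<open>M\<close>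
    provide one for each factor.\<close>
  obtain E1 :: "'a set" and E2 :: "'b set" where "is_onb E1" "is_onb E2"
    using T1_tc T2_tc unfolding trace_class_def by blast
  then have factors: "trace_class M1 \<and> trace_class M2" if "M \<noteq> (\<lambda>_. 0)"
    using nonzero_fst_trace_class nonzero_snd_trace_class that M_tc unfolding M1_eq M2_eq by blast
  note pt = partial_trace_fst[OF T1 M_tc factors[unfolded M1_eq M2_eq], folded M1_eq M2_eq]
    partial_trace_snd[OF T2 M_tc factors[unfolded M1_eq M2_eq], folded M1_eq M2_eq]
  have M_eq: "M = op_tensor t M1 M2"
    using eq_op_tensor unfolding M1_eq M2_eq .
  have smeas: "(\<lambda>x. op_trace M2 * m1 x) \<in> borel_measurable X1"
    "(\<lambda>y. op_trace M1 * m2 y) \<in> borel_measurable X2"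
    using meas by measurable
  have "bessel_multiplier X1 m1 F1 G1 M1 \<and> bessel_multiplier X2 m2 F2 G2 M2"
    if "M \<noteq> (\<lambda>_. 0)"
    using nonzero_fst_factor(2)[OF that] nonzero_snd_factor(2)[OF that] meas bessel
    unfolding bessel_multiplier_def M1_eq M2_eq by blast
  moreover have "bessel_multiplier X1 (\<lambda>x. op_trace M2 * m1 x) F1 G1 (T1 M)"
    "bessel_multiplier X2 (\<lambda>y. op_trace M1 * m2 y) F2 G2 (T2 M)"
    unfolding bessel_multiplier_def using smeas bessel pt by blast+
  moreover have "frame_multiplier X1 (\<lambda>x. op_trace M2 * m1 x) F1 G1 (T1 M) \<and>
      frame_multiplier X2 (\<lambda>y. op_trace M1 * m2 y) F2 G2 (T2 M)"
    if "continuous_frame X1 F1 \<and> continuous_frame X1 G1 \<and>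
      continuous_frame X2 F2 \<and> continuous_frame X2 G2"
    unfolding frame_multiplier_def using that smeas pt by blast
  ultimately show ?thesis
    using M_eq[symmetric] factors T1_tc T2_tc pt by simp
qed

end
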